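(* Let $\alpha\in(0,1)$, $\alpha>\frac14$, $\alpha\ne\frac12$, and let $t>0$. For $\varepsilon_1,\varepsilon_2>0$ let $$\mathcal V(\varepsilon_1,\varepsilon_2)_t=\mathbb{E}\left[\left(\int_0^t\Gamma'(\varepsilon_1)^{(1)}_{x_1}dx_1\int_0^{x_1}\Gamma'(\varepsilon_2)^{(2)}_{x_2}dx_2\right)^2\right],$$ where $\Gamma(\varepsilon)^{(1)},\Gamma(\varepsilon)^{(2)}$ are the two independent components of the analytic approximation of two-dimensional fractional Brownian motion described in the context. Suppose $\varepsilon_1,\varepsilon_2\to0$ jointly, i.e. $\varepsilon_1,\varepsilon_2\to0$ and $\varepsilon_1/\varepsilon_2\to1$. Then $$\mathcal V(\varepsilon_1,\varepsilon_2)_t\longrightarrow C_\alpha t^{4\alpha},$$ where $$C_\alpha=\frac{\alpha(2\alpha-1)}{2}\left[\frac{2\,\Gamma(2\alpha-1)\Gamma(2\alpha+1)}{\Gamma(4\alpha+1)}+\frac{1}{(2\alpha-1)(4\alpha-1)}\right],$$ and in the last formula $\Gamma(\cdot)$ is the Euler Gamma function.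
   Context: Powers $z^\beta$ ($z\in\mathbb{C}\setminus\mathbb{R}_-$) use the principal logarithm. Let $\Gamma'^{+}$ be the complex centered Gaussian process on the open upper half-plane $\Pi^+$, a.s. analytic, with $\Gamma'^-_{\bar z}:=\overline{\Gamma'^+_z}$ and covariances $\mathbb{E}[\Gamma'^+_z\Gamma'^+_w]=\mathbb{E}[\Gamma'^-_{\bar z}\Gamma'^-_{\bar w}]=0$, $\mathbb{E}[\Gamma'^+_z\Gamma'^-_{\bar w}]=\frac{\alpha(1-2\alpha)}{2\cos\pi\alpha}(-i(z-\bar w))^{2\alpha-2}$ for $z,w\in\Pi^+$. (Explicitly $\Gamma'^+_z=\sum_{k\ge0}f_k(z)\xi_k^+$ with $f_k(z)=2^{\alpha-1}\sqrt{\frac{\alpha(1-2\alpha)}{2\cos\pi\alpha}}\sqrt{\frac{(2-2\alpha)_k}{k!}}(\frac{z+i}{2i})^{2\alpha-2}(\frac{z-i}{z+i})^k$, $(x)_k=x(x+1)\cdots(x+k-1)$, and $\xi_k^+$ independent standard complex Gaussians with $\mathbb{E}|\xi_k^+|^2=1$, $\mathbb{E}[(\xi_k^+)^2]=0$.) Let $\Gamma^+_z=\int_0^z\Gamma'^+_u\,du$ (along any path in $\Pi^+$ from $0$ to $z$) and, for $\varepsilon>0$, $x\in\mathbb{R}$, $\Gamma(\varepsilon)_x=2\operatorname{Re}\Gamma^+_{x+i\varepsilon}$, so $\Gamma'(\varepsilon)_x=\frac{d}{dx}\Gamma(\varepsilon)_x=\Gamma'^+_{x+i\varepsilon}+\Gamma'^-_{x-i\varepsilon}$.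 $\Gamma(\varepsilon)^{(1)},\Gamma(\varepsilon)^{(2)}$ are built from two independent copies of $\Gamma'^+$ (each copy being used for all values of $\varepsilon$). *)

theory Defs
  imports "HOL-Probability.Probability" "HOL-Complex_Analysis.Complex_Analysis"
begin

definition upper_half_plane :: "complex set" where
  "upper_half_plane = {z. Im z > 0}"

text \<open>Normal laws in the sense of Gaussian processes: the degenerate case of variance zero
  is included.\<close>

definition gaussian_rv :: "'a measure \<Rightarrow> ('a \<Rightarrow> real) \<Rightarrow> bool" where
  "gaussian_rv M X \<longleftrightarrow> X \<in> borel_measurable M \<and>
     ((\<exists>\<mu>. AE \<omega> in M. X \<omega> = \<mu>) \<or>
      (\<exists>\<mu> \<sigma>. \<sigma> > 0 \<and> distributed M lborel X (normal_density \<mu> \<sigma>)))"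

text \<open>A complex process indexed by \<open>I\<close> is Gaussian if its real and imaginary parts are jointly
  Gaussian, i.e. all their finite real linear combinations are Gaussian.\<close>

definition complex_gaussian_process ::
    "'a measure \<Rightarrow> 'i set \<Rightarrow> ('i \<Rightarrow> 'a \<Rightarrow> complex) \<Rightarrow> bool" where
  "complex_gaussian_process M I G \<longleftrightarrow>
     (\<forall>i\<in>I. G i \<in> borel_measurable M) \<and>
     (\<forall>S a b. finite S \<and> S \<subseteq> I \<longrightarrow>
        gaussian_rv M (\<lambda>\<omega>. \<Sum>i\<in>S. a i * Re (G i \<omega>) + b i * Im (G i \<omega>)))"

definition conj_process :: "(complex \<Rightarrow> 'a \<Rightarrow> complex) \<Rightarrow> complex \<Rightarrow> 'a \<Rightarrow> complex" where
  "conj_process G w \<omega> = cnj (G (cnj w) \<omega>)"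

text \<open>\<open>G\<close> is a version of the process \<open>\<Gamma>'\<^sup>+\<close> of index \<open>\<alpha>\<close>, and \<open>conj_process G\<close>, which lives on
  the lower half-plane, is the corresponding \<open>\<Gamma>'\<^sup>-\<close>.  Only the values of \<open>G\<close> on the upper
  half-plane matter.  The base of the power has positive real part, so \<open>powr\<close> is the
  principal power.\<close>

definition fbm_gamma_deriv :: "real \<Rightarrow> 'a measure \<Rightarrow> (complex \<Rightarrow> 'a \<Rightarrow> complex) \<Rightarrow> bool" where
  "fbm_gamma_deriv \<alpha> M G \<longleftrightarrow>
     complex_gaussian_process M upper_half_plane G \<and>
     (AE \<omega> in M. (\<lambda>z. G z \<omega>) analytic_on upper_half_plane) \<and>
     (\<forall>z\<in>upper_half_plane. (LINT \<omega>|M. G z \<omega>) = 0) \<and>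
     (\<forall>z\<in>upper_half_plane. \<forall>w\<in>upper_half_plane.
        (LINT \<omega>|M. G z \<omega> * G w \<omega>) = 0 \<and>
        (LINT \<omega>|M. conj_process G (cnj z) \<omega> * conj_process G (cnj w) \<omega>) = 0 \<and>
        (LINT \<omega>|M. G z \<omega> * conj_process G (cnj w) \<omega>) =
          complex_of_real (\<alpha> * (1 - 2 * \<alpha>) / (2 * cos (pi * \<alpha>))) *
            (- \<i> * (z - cnj w)) powr complex_of_real (2 * \<alpha> - 2))"

text \<open>Independence of two processes is independence of the random elements
  \<open>(G z)\<^sub>z\<close> of the product space over the upper half-plane.\<close>

definition independent_processes ::
    "'a measure \<Rightarrow> (complex \<Rightarrow> 'a \<Rightarrow> complex) \<Rightarrow> (complex \<Rightarrow> 'a \<Rightarrow> complex) \<Rightarrow> bool" where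
  "independent_processes M G H \<longleftrightarrow>
     prob_space.indep_var M
       (PiM upper_half_plane (\<lambda>_. borel)) (\<lambda>\<omega>. \<lambda>z\<in>upper_half_plane. G z \<omega>)
       (PiM upper_half_plane (\<lambda>_. borel)) (\<lambda>\<omega>. \<lambda>z\<in>upper_half_plane. H z \<omega>)"

text \<open>\<open>\<Gamma>'(\<epsilon>)\<^sub>x = \<Gamma>'\<^sup>+(x + \<i>\<epsilon>) + \<Gamma>'\<^sup>-(x - \<i>\<epsilon>)\<close>.  The sum is real, and \<open>Re\<close> only adjusts the type.\<close>

definition Gamma_eps_deriv ::
    "(complex \<Rightarrow> 'a \<Rightarrow> complex) \<Rightarrow> real \<Rightarrow> real \<Rightarrow> 'a \<Rightarrow> real" where
  "Gamma_eps_deriv G \<epsilon> x \<omega> =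
     Re (G (Complex x \<epsilon>) \<omega> + conj_process G (Complex x (- \<epsilon>)) \<omega>)"

text \<open>Consistency with \<open>\<Gamma>(\<epsilon>)\<^sub>x = 2 Re \<Gamma>\<^sup>+(x + \<i>\<epsilon>)\<close>, where the path \<open>F\<close> of \<open>\<Gamma>\<^sup>+\<close> is a
  primitive of the path of \<open>\<Gamma>'\<^sup>+\<close>.\<close>

lemma Gamma_eps_deriv_is_derivative:
  assumes F: "\<And>z. z \<in> upper_half_plane \<Longrightarrow> (F has_field_derivative G z \<omega>) (at z)"
    and "\<epsilon> > 0"
  shows "((\<lambda>x. 2 * Re (F (Complex x \<epsilon>))) has_real_derivative Gamma_eps_deriv G \<epsilon> x \<omega>) (at x)"
proof -
  have eq: "Complex y \<epsilon> = of_real y + \<i> * of_real \<epsilon>" for y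
    by (simp add: complex_eq_iff)
  have 1: "((\<lambda>y. Complex y \<epsilon>) has_vector_derivative 1) (at x)"
    unfolding eq by (auto intro!: derivative_eq_intros)
  have "(F \<circ> (\<lambda>y. Complex y \<epsilon>) has_vector_derivative (1 * G (Complex x \<epsilon>) \<omega>)) (at x)"
    by (rule field_vector_diff_chain_at[OF 1 F]) (use assms in \<open>auto simp: upper_half_plane_def\<close>)
  then have "((\<lambda>y. F (Complex y \<epsilon>)) has_vector_derivative G (Complex x \<epsilon>) \<omega>) (at x)"
    by (simp add: o_def)
  then have "((\<lambda>y. Re (F (Complex y \<epsilon>))) has_real_derivative Re (G (Complex x \<epsilon>) \<omega>)) (at x)"
    by (auto simp: has_real_derivative_iff_has_vector_derivative has_vector_derivative_complex_iff)
  from DERIV_cmult[OF this, of 2] show ?thesis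
    by (simp add: Gamma_eps_deriv_def conj_process_def complex_cnj)
qed

definition iterated_integral ::
    "(complex \<Rightarrow> 'a \<Rightarrow> complex) \<Rightarrow> (complex \<Rightarrow> 'a \<Rightarrow> complex) \<Rightarrow>
       real \<Rightarrow> real \<Rightarrow> real \<Rightarrow> 'a \<Rightarrow> real" where
  "iterated_integral G1 G2 \<epsilon>1 \<epsilon>2 t \<omega> =
     (LBINT x1:{0..t}. Gamma_eps_deriv G1 \<epsilon>1 x1 \<omega> *
        (LBINT x2:{0..x1}. Gamma_eps_deriv G2 \<epsilon>2 x2 \<omega>))"

text \<open>The paths are regular only almost surely, so on an incomplete probability space the iterated
  integral need not be measurable on the exceptional null set.  The expectation is
  therefore taken with respect to the completion of \<open>M\<close>; for functions measurable with respect to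
  \<open>M\<close> it is the expectation with respect to \<open>M\<close>.\<close>

definition area_second_moment ::
    "'a measure \<Rightarrow> (complex \<Rightarrow> 'a \<Rightarrow> complex) \<Rightarrow> (complex \<Rightarrow> 'a \<Rightarrow> complex) \<Rightarrow>
       real \<Rightarrow> real \<Rightarrow> real \<Rightarrow> real" where
  "area_second_moment M G1 G2 \<epsilon>1 \<epsilon>2 t =
     (LINT \<omega>|completion M. (iterated_integral G1 G2 \<epsilon>1 \<epsilon>2 t \<omega>)\<^sup>2)"

text \<open>The filter of pairs \<open>(\<epsilon>1, \<epsilon>2)\<close> of positive reals with \<open>\<epsilon>1, \<epsilon>2 \<rightarrow> 0\<close> and
  \<open>\<epsilon>1 / \<epsilon>2 \<rightarrow> 1\<close>.\<close>

definition jointly_to_zero :: "(real \<times> real) filter" where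
  "jointly_to_zero =
     inf (at_right 0 \<times>\<^sub>F at_right 0) (filtercomap (\<lambda>(\<epsilon>1, \<epsilon>2). \<epsilon>1 / \<epsilon>2) (nhds 1))"

definition C_area :: "real \<Rightarrow> real" where
  "C_area \<alpha> = \<alpha> * (2 * \<alpha> - 1) / 2 *
     (2 * Gamma (2 * \<alpha> - 1) * Gamma (2 * \<alpha> + 1) / Gamma (4 * \<alpha> + 1) +
      1 / ((2 * \<alpha> - 1) * (4 * \<alpha> - 1)))"

end

theory Submission imports Defs begin

text \<open>
  Write \<open>a = 2 * \<alpha>\<close>. The process \<open>\<Gamma>'(\<epsilon>)\<close> is stationary with covariance kernel \<open>k(s) = h''(s)\<close>, where
  \<open>h(s) = Re ((2 \<epsilon> - \<i> s) powr a) / (2 cos (pi \<alpha>))\<close> is a smooth regularisation of \<open>\<bar>s\<bar> powr a / 2\<close>. Let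
  \<open>h\<^sub>1, h\<^sub>2\<close> be the functions belonging to \<open>\<epsilon>1, \<epsilon>2\<close>. Fubini's theorem and the independence of the two
  components express the second moment by the two covariances alone, as the integral of
  \<open>h\<^sub>1''(x - y) h\<^sub>2''(u - v)\<close> over \<open>0 \<le> u \<le> x \<le> t\<close>, \<open>0 \<le> v \<le> y \<le> t\<close>
  (\<open>second_moment_iterated_integral\<close>).

  In the limit the kernel \<open>h\<^sub>1''\<close> becomes \<open>a (a - 1) / 2 * \<bar>s\<bar> powr (a - 2)\<close>, which is not integrable at zero if
  \<open>\<alpha> < 1/2\<close>. So the limit must not be taken yet. Integrating as far as possible while everything is smooth
  (\<open>integral_convolution_second_derivatives\<close>) gives
  \<open>\<integral>\<^sub>0\<^sup>t (2 h\<^sub>2(x) - h\<^sub>2(0)) (h\<^sub>1'(x) - h\<^sub>1'(x - t)) dx - 2 \<integral>\<^sub>0\<^sup>t \<integral>\<^sub>0\<^sup>x h\<^sub>1''(s) h\<^sub>2(s) ds dx\<close>.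
  Now the two integrands have integrable singularities of order \<open>a - 1\<close> and \<open>2 a - 2\<close>, the latter
  because \<open>\<alpha> > 1/4\<close> and because \<open>\<epsilon>2 / \<epsilon>1\<close> remains bounded. Dominated convergence
  (\<open>cross_term_limit\<close>, \<open>diagonal_term_limit\<close>) yields the limits
  \<open>t powr (2 a) (1/4 + a/2 Beta (a + 1) a)\<close> of the first integral and
  \<open>t powr (2 a) (a - 1) / (8 (2 a - 1))\<close> of the second one, from which
  \<open>C_area \<alpha>\<close> is obtained with \<open>(2 \<alpha> - 1) Gamma (2 \<alpha> - 1) = Gamma (2 \<alpha>)\<close>.
\<close>

section \<open>The regularised covariance kernel\<close>

definition cpow :: "real \<Rightarrow> real \<Rightarrow> real \<Rightarrow> complex" where
  "cpow p e s = (complex_of_real e - \<i> * complex_of_real s) powr complex_of_real p"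

lemma norm_cpow: "norm (cpow p e s) = norm (complex_of_real e - \<i> * complex_of_real s) powr p"
  unfolding cpow_def by (subst norm_powr_real_powr') auto

lemma cpow_minus: "e > 0 \<Longrightarrow> cpow p e (- s) = cnj (cpow p e s)"
  unfolding cpow_def by (subst cnj_powr) (auto simp: complex_nonpos_Reals_iff)

lemma has_vector_derivative_cpow:
  assumes "e > 0"
  shows "(cpow p e has_vector_derivative (- \<i> * complex_of_real p * cpow (p - 1) e s)) (at s)"
proof -
  have 1: "((\<lambda>s. complex_of_real e - \<i> * complex_of_real s) has_vector_derivative - \<i>) (at s)"
    by (auto intro!: derivative_eq_intros)
  have "((\<lambda>z. z powr complex_of_real p) \<circ> (\<lambda>s. complex_of_real e - \<i> * complex_of_real s)
      has_vector_derivative (- \<i> * (complex_of_real p *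
        (complex_of_real e - \<i> * complex_of_real s) powr (complex_of_real p - 1)))) (at s)"
    by (rule field_vector_diff_chain_at[OF 1 has_field_derivative_powr])
      (use assms in \<open>auto simp: complex_nonpos_Reals_iff\<close>)
  then show ?thesis
    by (simp add: cpow_def[abs_def] o_def mult.assoc)
qed

lemma continuous_on_cpow: "e > 0 \<Longrightarrow> continuous_on A (cpow p e)"
  by (meson continuous_at_imp_continuous_on has_vector_derivative_continuous
      has_vector_derivative_cpow)

text \<open>For \<open>e = 0\<close> and \<open>s > 0\<close> the base \<open>- \<i> s\<close> lies on the boundary of the right half-plane with argument
  \<open>- pi / 2\<close>, still off the branch cut.\<close>

lemma cpow_zero_left:
  assumes "s > 0"
  shows "cpow p 0 s = s powr p *\<^sub>R cis (- (pi * p / 2))"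
proof -
  have "Ln (- \<i> * complex_of_real s) = complex_of_real (ln s) - \<i> * complex_of_real (pi / 2)"
    using assms Ln_times_of_real[of s "- \<i>"] by (simp add: Ln_of_real mult.commute)
  then have "cpow p 0 s = exp (complex_of_real p * (complex_of_real (ln s) - \<i> * complex_of_real (pi / 2)))"
    using assms by (simp add: cpow_def powr_def)
  also have "\<dots> = exp (complex_of_real (p * ln s)) * exp (\<i> * complex_of_real (- (pi * p / 2)))"
    unfolding exp_add[symmetric] by (simp add: algebra_simps)
  finally have "cpow p 0 s = exp (complex_of_real (p * ln s)) * exp (\<i> * complex_of_real (- (pi * p / 2)))" .
  then show ?thesis
    using assms by (simp add: cis_conv_exp powr_def scaleR_conv_of_real exp_of_real[symmetric])
qed

lemma tendsto_cpow:
  assumes "s > 0" "e \<longlonglongrightarrow> 0"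
  shows "(\<lambda>n. cpow p (e n) s) \<longlonglongrightarrow> s powr p *\<^sub>R cis (- (pi * p / 2))"
proof -
  have "(\<lambda>n. cpow p (e n) s) \<longlonglongrightarrow> cpow p 0 s"
    unfolding cpow_def
    by (intro tendsto_powr_complex tendsto_intros assms)
       (use assms in \<open>auto simp: complex_nonpos_Reals_iff\<close>)
  then show ?thesis using cpow_zero_left[OF assms(1)] by simp
qed

text \<open>The next two estimates are what dominated convergence needs: bounds that are uniform in the
  regularisation parameter \<open>e\<close> and integrable at \<open>s = 0\<close> as soon as \<open>p > -1\<close>. They come from
  \<open>\<bar>s\<bar> \<le> \<bar>e - \<i> s\<bar> \<le> 1 + t\<close>, using the lower bound for negative exponents and the upper bound
  for the others.\<close>

lemma norm_cpow_le_nonneg: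
  assumes "0 \<le> e" "e \<le> 1" "\<bar>s\<bar> \<le> t" "0 \<le> p"
  shows "norm (cpow p e s) \<le> (1 + t) powr p"
proof -
  let ?z = "complex_of_real e - \<i> * complex_of_real s"
  have "norm ?z \<le> 1 + t"
    using norm_triangle_ineq4[of "complex_of_real e" "\<i> * complex_of_real s"] assms
    by (simp add: norm_mult)
  then show ?thesis unfolding norm_cpow
    using powr_mono2[of p "norm ?z" "1 + t"] assms by auto
qed

lemma norm_cpow_le:
  assumes "0 \<le> e" "e \<le> 1" "s \<noteq> 0" "\<bar>s\<bar> \<le> t"
  shows "norm (cpow p e s) \<le> \<bar>s\<bar> powr p + (1 + t) powr p"
proof (cases "p < 0")
  case True
  have "\<bar>s\<bar> \<le> norm (complex_of_real e - \<i> * complex_of_real s)"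
    using abs_Im_le_cmod[of "complex_of_real e - \<i> * complex_of_real s"] by simp
  then have "norm (cpow p e s) \<le> \<bar>s\<bar> powr p"
    unfolding norm_cpow using assms True by (intro powr_mono2') auto
  then show ?thesis using powr_ge_zero[of "1 + t" p] by linarith
next
  case False
  then show ?thesis
    using norm_cpow_le_nonneg[of e s t p] assms powr_ge_zero[of "\<bar>s\<bar>" p] by linarith
qed

text \<open>This is where the two regularisation parameters have to stay comparable. A singular power taken at
  \<open>e1\<close> can absorb a positive power taken at \<open>e2\<close>, leaving the sum of the exponents, only because
  \<open>\<bar>e2 - \<i> s\<bar> \<le> 2 \<bar>e1 - \<i> s\<bar>\<close>. If \<open>e1\<close> tended to zero much faster than \<open>e2\<close>, the product near
  \<open>s = 0\<close> would be of order \<open>\<bar>s\<bar> powr p * e2 powr q\<close>, which is not dominated by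
  \<open>\<bar>s\<bar> powr (p + q)\<close>.\<close>

lemma norm_cpow_mult_le:
  assumes "0 \<le> e2" "e2 \<le> 2 * e1" "0 \<le> q" "s \<noteq> 0"
  shows "norm (cpow p e1 s) * norm (cpow q e2 s) \<le> 2 powr q * norm (cpow (p + q) e1 s)"
proof -
  let ?z = "\<lambda>e. complex_of_real e - \<i> * complex_of_real s"
  have n: "norm (?z e) = sqrt (e\<^sup>2 + s\<^sup>2)" for e
    by (simp add: cmod_def)
  have "e2\<^sup>2 \<le> (2 * e1)\<^sup>2" using assms by (intro power_mono) auto
  then have "e2\<^sup>2 + s\<^sup>2 \<le> 2\<^sup>2 * (e1\<^sup>2 + s\<^sup>2)"
    by (simp add: power_mult_distrib) (use zero_le_power2[of s] in linarith)
  then have "sqrt (e2\<^sup>2 + s\<^sup>2) \<le> sqrt (2\<^sup>2 * (e1\<^sup>2 + s\<^sup>2))"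
    by (rule real_sqrt_le_mono)
  then have le: "norm (?z e2) \<le> 2 * norm (?z e1)"
    unfolding n real_sqrt_mult by simp
  have "norm (?z e2) powr q \<le> (2 * norm (?z e1)) powr q"
    using le assms by (intro powr_mono2) auto
  then have "norm (?z e1) powr p * norm (?z e2) powr q \<le> norm (?z e1) powr p * (2 * norm (?z e1)) powr q"
    by (intro mult_left_mono) auto
  also have "\<dots> = 2 powr q * norm (?z e1) powr (p + q)"
    by (simp add: powr_mult powr_add mult_ac)
  finally show ?thesis unfolding norm_cpow .
qed

text \<open>With \<open>a = 2 * \<alpha>\<close> and \<open>e = 2 * \<epsilon>\<close>, \<open>half_var''\<close> is the covariance kernel of the stationary process
  \<open>\<Gamma>'(\<epsilon>)\<close>; \<open>half_var\<close> is a second primitive of it, normalised to converge to \<open>\<bar>s\<bar> powr a / 2\<close>, half the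
  variance of an increment of fractional Brownian motion. Accordingly the covariance of the integrated
  process is \<open>half_var x + half_var y - half_var (x - y) - half_var 0\<close>.\<close>

definition half_var :: "real \<Rightarrow> real \<Rightarrow> real \<Rightarrow> real" where
  "half_var a e s = Re (cpow a e s) / (2 * cos (pi * a / 2))"

definition half_var' :: "real \<Rightarrow> real \<Rightarrow> real \<Rightarrow> real" where
  "half_var' a e s = a * Im (cpow (a - 1) e s) / (2 * cos (pi * a / 2))"

definition half_var'' :: "real \<Rightarrow> real \<Rightarrow> real \<Rightarrow> real" where
  "half_var'' a e s = a * (1 - a) * Re (cpow (a - 2) e s) / (2 * cos (pi * a / 2))"

lemma DERIV_half_var: "e > 0 \<Longrightarrow> (half_var a e has_real_derivative half_var' a e s) (at s)"
  using has_vector_derivative_cpow[of e a s]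
  unfolding half_var_def[abs_def] half_var'_def
  by (intro DERIV_cdivide)
    (auto simp: has_real_derivative_iff_has_vector_derivative has_vector_derivative_complex_iff)

lemma DERIV_half_var': 
  assumes "e > 0" shows "(half_var' a e has_real_derivative half_var'' a e s) (at s)"
proof -
  have "((\<lambda>s. Im (cpow (a - 1) e s)) has_real_derivative (1 - a) * Re (cpow (a - 2) e s)) (at s)"
    using has_vector_derivative_cpow[OF assms, of "a - 1" s]
    by (auto simp: has_real_derivative_iff_has_vector_derivative has_vector_derivative_complex_iff algebra_simps)
  from DERIV_cdivide[OF DERIV_cmult[OF this, of a], of "2 * cos (pi * a / 2)"] show ?thesis
    unfolding half_var'_def[abs_def] half_var''_def by (simp add: mult.assoc)
qed

lemma half_var_minus:
  assumes "e > 0"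
  shows "half_var a e (- s) = half_var a e s" "half_var' a e (- s) = - half_var' a e s" "half_var'' a e (- s) = half_var'' a e s"
  using assms by (simp_all add: half_var_def half_var'_def half_var''_def cpow_minus)

lemma continuous_on_half_var:
  assumes "e > 0"
  shows "continuous_on A (half_var a e)" "continuous_on A (half_var' a e)" "continuous_on A (half_var'' a e)"
  unfolding half_var_def[abs_def] half_var'_def[abs_def] half_var''_def[abs_def] divide_inverse
  by (intro continuous_intros continuous_on_cpow assms)+

lemma tendsto_half_var:
  assumes "s > 0" "e \<longlonglongrightarrow> 0" "cos (pi * a / 2) \<noteq> 0"
  shows "(\<lambda>n. half_var a (e n) s) \<longlonglongrightarrow> s powr a / 2"
    and "(\<lambda>n. half_var' a (e n) s) \<longlonglongrightarrow> a / 2 * s powr (a - 1)"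
    and "(\<lambda>n. half_var'' a (e n) s) \<longlonglongrightarrow> a * (a - 1) / 2 * s powr (a - 2)"
proof -
  let ?c = "cos (pi * a / 2)"
  have "(\<lambda>n. half_var a (e n) s) \<longlonglongrightarrow> Re (s powr a *\<^sub>R cis (- (pi * a / 2))) / (2 * ?c)"
    unfolding half_var_def by (intro tendsto_intros tendsto_cpow) (use assms in auto)
  then show "(\<lambda>n. half_var a (e n) s) \<longlonglongrightarrow> s powr a / 2"
    using assms by simp
  have "(\<lambda>n. half_var' a (e n) s) \<longlonglongrightarrow> a * Im (s powr (a - 1) *\<^sub>R cis (- (pi * (a - 1) / 2))) / (2 * ?c)"
    unfolding half_var'_def by (intro tendsto_intros tendsto_cpow) (use assms in auto)
  moreover have "sin (- (pi * (a - 1) / 2)) = ?c"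
  proof -
    have "- (pi * (a - 1) / 2) = pi / 2 - pi * a / 2" by (simp add: field_simps)
    then show ?thesis by (simp only: sin_diff) simp
  qed
  ultimately have "(\<lambda>n. half_var' a (e n) s) \<longlonglongrightarrow> a * (s powr (a - 1) * ?c) / (2 * ?c)"
    by (simp only: scaleR_complex.sel cis.sel)
  then show "(\<lambda>n. half_var' a (e n) s) \<longlonglongrightarrow> a / 2 * s powr (a - 1)"
    using assms by simp
  have "(\<lambda>n. half_var'' a (e n) s) \<longlonglongrightarrow> a * (1 - a) * Re (s powr (a - 2) *\<^sub>R cis (- (pi * (a - 2) / 2))) / (2 * ?c)"
    unfolding half_var''_def by (intro tendsto_intros tendsto_cpow) (use assms in auto)
  moreover have "cos (- (pi * (a - 2) / 2)) = - ?c"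
  proof -
    have "- (pi * (a - 2) / 2) = pi - pi * a / 2" by (simp add: field_simps)
    then show ?thesis by (simp only: cos_diff) simp
  qed
  ultimately have "(\<lambda>n. half_var'' a (e n) s) \<longlonglongrightarrow> a * (1 - a) * (s powr (a - 2) * - ?c) / (2 * ?c)"
    by simp
  also have "a * (1 - a) * (s powr (a - 2) * - ?c) / (2 * ?c) = a * (a - 1) / 2 * s powr (a - 2)"
    using assms by (simp add: field_simps)
  finally show "(\<lambda>n. half_var'' a (e n) s) \<longlonglongrightarrow> a * (a - 1) / 2 * s powr (a - 2)" .
qed

lemma abs_half_var_le:
  shows "\<bar>half_var a e s\<bar> \<le> norm (cpow a e s) / (2 * \<bar>cos (pi * a / 2)\<bar>)"
    and "\<bar>half_var' a e s\<bar> \<le> \<bar>a\<bar> * norm (cpow (a - 1) e s) / (2 * \<bar>cos (pi * a / 2)\<bar>)"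
    and "\<bar>half_var'' a e s\<bar> \<le> \<bar>a * (1 - a)\<bar> * norm (cpow (a - 2) e s) / (2 * \<bar>cos (pi * a / 2)\<bar>)"
  unfolding half_var_def half_var'_def half_var''_def
  by (auto simp: abs_mult intro!: divide_right_mono mult_left_mono abs_Re_le_cmod abs_Im_le_cmod)

section \<open>Convolution integrals of second derivatives\<close>

lemma integral_Icc_FTC:
  fixes F f :: "real \<Rightarrow> real"
  assumes "a \<le> b" "\<And>x. (F has_real_derivative f x) (at x)"
  shows "integral {a..b} f = F b - F a"
  using assms
  by (intro integral_unique fundamental_theorem_of_calculus)
    (auto simp: has_real_derivative_iff_has_vector_derivative has_vector_derivative_at_within)

lemma integral_swap_Icc:
  fixes f :: "real \<Rightarrow> real \<Rightarrow> real"
  assumes "continuous_on UNIV (\<lambda>(x, y). f x y)"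
  shows "integral {a..b} (\<lambda>x. integral {c..d} (f x)) = integral {c..d} (\<lambda>y. integral {a..b} (\<lambda>x. f x y))"
  using integral_swap_continuous[of a c b d f] assms
  by (simp add: continuous_on_subset)

lemma continuous_on_integral_param:
  fixes f :: "real \<Rightarrow> real \<Rightarrow> real"
  assumes "continuous_on UNIV (\<lambda>(x, y). f x y)"
  shows "continuous_on A (\<lambda>x. integral {c..d} (f x))"
  using integral_continuous_on_param[of A c d f] assms
  by (simp add: continuous_on_subset)

lemma has_integral_reflect_Icc:
  fixes f :: "real \<Rightarrow> real"
  assumes "(f has_integral I) {0..t}"
  shows "((\<lambda>x. f (t - x)) has_integral I) {0..t}"
  using assms has_integral_shift_real_ivl[of "\<lambda>x. f (- x)" I "- t" 0 "- t"]
    Henstock_Kurzweil_Integration.has_integral_reflect_real[of f I t 0]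
  by simp

lemma integral_reflect_Icc:
  fixes f :: "real \<Rightarrow> real"
  shows "integral {0..t} (\<lambda>x. f (t - x)) = integral {0..t} f"
  using integral_shift_real_ivl[of "- t" "- t" 0 "\<lambda>x. f (- x)"]
    Henstock_Kurzweil_Integration.integral_reflect_real[of t 0 f]
  by simp

lemma integral_even_convolution:
  fixes \<phi> :: "real \<Rightarrow> real"
  assumes cont: "continuous_on UNIV \<phi>" and even: "\<And>s. \<phi> (- s) = \<phi> s" and "0 \<le> x" "x \<le> t"
  shows "integral {0..t} (\<lambda>y. \<phi> (x - y)) = integral {0..x} \<phi> + integral {0..t - x} \<phi>"
proof -
  have cont': "continuous_on A \<phi>" "continuous_on A (\<lambda>y. \<phi> (x - y))" for A
    by (auto intro!: continuous_intros continuous_on_compose2[OF cont])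
  have "integral {0..t} (\<lambda>y. \<phi> (x - y)) =
      integral {0..x} (\<lambda>y. \<phi> (x - y)) + integral {x..t} (\<lambda>y. \<phi> (x - y))"
    using assms by (intro Henstock_Kurzweil_Integration.integral_combine[symmetric] integrable_continuous_interval cont') auto
  also have "integral {x..t} (\<lambda>y. \<phi> (x - y)) = integral {x..t} (\<lambda>y. \<phi> (y - x))"
    by (intro integral_cong) (use even[of "_ - x"] in \<open>simp add: minus_diff_eq\<close>)
  also have "\<dots> = integral {0..t - x} \<phi>"
    using integral_shift_real_ivl[of 0 "- x" "t - x" \<phi>] by simp
  finally show ?thesis by (simp add: integral_reflect_Icc)
qed

text \<open>All four integrations are carried out on primitives. Integrating \<open>g2\<close> over \<open>u\<close> and \<open>v\<close> turns it into
  \<open>g x + g y - g 0 - g (x - y)\<close>. The terms of this sum that depend on one variable at most leave \<open>f2\<close> to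
  be integrated alone into \<open>f1\<close>; by symmetry \<open>g x\<close> and \<open>g y\<close> contribute equally. Only the term \<open>g (x - y)\<close>
  remains multiplied by \<open>f2 (x - y)\<close>. The gain is that in the first integral on the right the
  singular kernel \<open>f2\<close> has been replaced by the less singular \<open>f1\<close>; in the second integral the
  singularity of \<open>f2\<close> at zero will be compensated by the smallness of \<open>g\<close> there.\<close>

lemma integral_convolution_second_derivatives:
  fixes f1 f2 g g1 g2 :: "real \<Rightarrow> real"
  assumes f: "\<And>s. (f1 has_real_derivative f2 s) (at s)" "continuous_on UNIV f2"
    and g: "\<And>s. (g has_real_derivative g1 s) (at s)" "\<And>s. (g1 has_real_derivative g2 s) (at s)"
    and sym: "\<And>s. f1 (- s) = - f1 s" "\<And>s. f2 (- s) = f2 s" "\<And>s. g (- s) = g s"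
    and t: "0 \<le> t"
  shows "integral {0..t} (\<lambda>x. integral {0..x} (\<lambda>u. integral {0..t} (\<lambda>y. integral {0..y} (\<lambda>v.
            f2 (x - y) * g2 (u - v))))) =
          integral {0..t} (\<lambda>x. (2 * g x - g 0) * (f1 x - f1 (x - t))) -
            2 * integral {0..t} (\<lambda>x. integral {0..x} (\<lambda>s. f2 s * g s))"
proof -
  have cont_at: "continuous_on A h" if "\<And>s. (h has_real_derivative h' s) (at s)" for A h h'
    using that by (meson DERIV_isCont continuous_at_imp_continuous_on)
  have c: "continuous_on UNIV f1" "continuous_on UNIV g" "continuous_on UNIV g1"
    by (rule cont_at f g)+
  note cc = continuous_on_compose2[OF f(2)] continuous_on_compose2[OF c(1)]
    continuous_on_compose2[OF c(2)] continuous_on_compose2[OF c(3)]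
  have i1: "integral {0..y} (\<lambda>v. f2 (x - y) * g2 (u - v)) = f2 (x - y) * (g1 u - g1 (u - y))"
    if "0 \<le> y" for x y u
  proof -
    have "integral {0..y} (\<lambda>v. g2 (u - v)) = - g1 (u - y) - (- g1 (u - 0))"
      by (rule integral_Icc_FTC[OF that]) (auto intro!: derivative_eq_intros DERIV_chain2[OF g(2)])
    then show ?thesis by simp
  qed
  have i2: "integral {0..x} (\<lambda>u. f2 (x - y) * (g1 u - g1 (u - y))) =
      f2 (x - y) * (g x + g y - g 0 - g (x - y))" if "0 \<le> x" for x y
  proof -
    have "integral {0..x} (\<lambda>u. g1 u - g1 (u - y)) = (g x - g (x - y)) - (g 0 - g (0 - y))"
      by (rule integral_Icc_FTC[OF that])
        (auto intro!: derivative_eq_intros g(1) DERIV_chain2[OF g(1)])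
    then show ?thesis using sym(3)[of y] by simp
  qed
  have int_f2: "integral {0..t} (\<lambda>y. f2 (x - y)) = f1 x - f1 (x - t)" for x
  proof -
    have "integral {0..t} (\<lambda>y. f2 (x - y)) = - f1 (x - t) - (- f1 (x - 0))"
      by (rule integral_Icc_FTC[OF t]) (auto intro!: derivative_eq_intros DERIV_chain2[OF f(1)])
    then show ?thesis by simp
  qed
  have "integral {0..t} (\<lambda>x. integral {0..x} (\<lambda>u. integral {0..t} (\<lambda>y. integral {0..y} (\<lambda>v.
            f2 (x - y) * g2 (u - v))))) =
      integral {0..t} (\<lambda>x. integral {0..x} (\<lambda>u. integral {0..t} (\<lambda>y. f2 (x - y) * (g1 u - g1 (u - y)))))"
    by (intro integral_cong i1) auto
  also have "\<dots> = integral {0..t} (\<lambda>x. integral {0..t} (\<lambda>y. integral {0..x} (\<lambda>u. f2 (x - y) * (g1 u - g1 (u - y)))))"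
    unfolding split_beta
    by (intro integral_cong integral_swap_Icc, unfold split_beta, intro cc continuous_intros) auto
  also have "\<dots> = integral {0..t} (\<lambda>x. integral {0..t} (\<lambda>y. f2 (x - y) * (g x + g y - g 0 - g (x - y))))"
    by (intro integral_cong i2) auto
  also have "\<dots> = integral {0..t} (\<lambda>x. integral {0..t} (\<lambda>y. f2 (x - y) * (g x - g 0))
      + integral {0..t} (\<lambda>y. f2 (x - y) * g y) - integral {0..t} (\<lambda>y. f2 (x - y) * g (x - y)))"
    (is "_ = integral _ (\<lambda>x. ?A x + ?B x - ?C x)")
  proof (intro integral_cong)
    fix x
    have "integral {0..t} (\<lambda>y. f2 (x - y) * (g x + g y - g 0 - g (x - y))) =
      integral {0..t} (\<lambda>y. f2 (x - y) * (g x - g 0) + f2 (x - y) * g y - f2 (x - y) * g (x - y))"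
      by (simp add: algebra_simps)
    also have "\<dots> = ?A x + ?B x - ?C x"
      by (subst integral_diff integral_add;
          (intro integrable_continuous_interval cc continuous_intros; simp)?)+ simp
    finally show "integral {0..t} (\<lambda>y. f2 (x - y) * (g x + g y - g 0 - g (x - y))) = ?A x + ?B x - ?C x" .
  qed
  also have "\<dots> = integral {0..t} ?A + integral {0..t} ?B - integral {0..t} ?C"
  proof -
    have "continuous_on {0..t} ?A" "continuous_on {0..t} ?B" "continuous_on {0..t} ?C"
      by (intro continuous_on_integral_param, unfold split_beta, intro cc continuous_intros; simp)+
    then show ?thesis
      by (simp add: integral_add integral_diff integrable_continuous_interval continuous_on_add)
  qed
  also have "integral {0..t} ?A = integral {0..t} (\<lambda>x. (g x - g 0) * (f1 x - f1 (x - t)))"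
    by (simp add: int_f2 mult.commute)
  also have "integral {0..t} ?B = integral {0..t} (\<lambda>y. integral {0..t} (\<lambda>x. f2 (x - y) * g y))"
    by (intro integral_swap_Icc, unfold split_beta, intro cc continuous_intros) auto
  also have "\<dots> = integral {0..t} (\<lambda>y. g y * (f1 y - f1 (y - t)))"
  proof (intro integral_cong)
    fix y
    have "integral {0..t} (\<lambda>x. f2 (x - y)) = integral {0..t} (\<lambda>x. f2 (y - x))"
      by (intro integral_cong) (use sym(2)[of "_ - y"] in \<open>simp add: minus_diff_eq\<close>)
    then show "integral {0..t} (\<lambda>x. f2 (x - y) * g y) = g y * (f1 y - f1 (y - t))"
      by (simp add: int_f2)
  qed
  also have "integral {0..t} ?C = 2 * integral {0..t} (\<lambda>x. integral {0..x} (\<lambda>s. f2 s * g s))"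
  proof -
    let ?P = "\<lambda>x. integral {0..x} (\<lambda>s. f2 s * g s)"
    have "integral {0..t} ?C = integral {0..t} (\<lambda>x. ?P x + ?P (t - x))"
      by (intro integral_cong integral_even_convolution continuous_intros f c)
        (auto simp: sym)
    also have "\<dots> = integral {0..t} ?P + integral {0..t} (\<lambda>x. ?P (t - x))"
    proof (rule integral_add)
      have P: "continuous_on {0..t} ?P"
        by (intro indefinite_integral_continuous_1 integrable_continuous_interval
            continuous_intros cc) auto
      then show "?P integrable_on {0..t}" by (rule integrable_continuous_interval)
      show "(\<lambda>x. ?P (t - x)) integrable_on {0..t}"
        by (intro integrable_continuous_interval continuous_on_compose2[OF P] continuous_intros) auto
    qed
    finally show ?thesis by (simp add: integral_reflect_Icc[of t ?P])
  qed
  also have "integral {0..t} (\<lambda>x. (g x - g 0) * (f1 x - f1 (x - t))) +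
      integral {0..t} (\<lambda>y. g y * (f1 y - f1 (y - t))) =
      integral {0..t} (\<lambda>x. (2 * g x - g 0) * (f1 x - f1 (x - t)))"
    by (subst integral_add[symmetric])
      ((intro integrable_continuous_interval cc continuous_intros; simp) | simp add: algebra_simps)+
  finally show ?thesis .
qed

section \<open>Removing the regularisation\<close>

lemma has_integral_Beta_scaled:
  fixes t :: real
  assumes "t > 0" "p > -1" "q > -1"
  shows "((\<lambda>x. x powr p * (t - x) powr q) has_integral t powr (p + q + 1) * Beta (p + 1) (q + 1)) {0..t}"
proof -
  have "((\<lambda>x. x powr p * (1 - x) powr q) has_integral Beta (p + 1) (q + 1)) {0..1}"
    using has_integral_Beta_real[of "p + 1" "q + 1"] assms by simp
  from has_integral_stretch_real[OF this, of "1 / t"]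
  have "((\<lambda>x. (x / t) powr p * (1 - x / t) powr q) has_integral t * Beta (p + 1) (q + 1)) {0..t}"
    using assms by (simp add: image_mult_atLeastAtMost mult.commute[of _ t])
  from has_integral_mult_right[OF this, of "t powr (p + q)"]
  have *: "((\<lambda>x. t powr (p + q) * ((x / t) powr p * (1 - x / t) powr q))
      has_integral t powr (p + q) * (t * Beta (p + 1) (q + 1))) {0..t}" .
  have scale: "t powr (p + q) * (t * Beta (p + 1) (q + 1)) = t powr (p + q + 1) * Beta (p + 1) (q + 1)"
    using assms by (simp add: powr_add)
  have **: "((\<lambda>x. t powr (p + q) * ((x / t) powr p * (1 - x / t) powr q))
      has_integral t powr (p + q + 1) * Beta (p + 1) (q + 1)) {0..t}"
    using * by (simp only: scale)
  have "t powr (p + q) * ((x / t) powr p * (1 - x / t) powr q) = x powr p * (t - x) powr q"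
    if "x \<in> {0..t}" for x
  proof -
    have "1 - x / t = (t - x) / t" using assms by (simp add: field_simps)
    then show ?thesis using that assms by (simp add: powr_divide powr_add)
  qed
  then show ?thesis
    by (rule has_integral_eq[OF _ **])
qed

lemma cos_pi_half_nonzero:
  assumes "0 < a" "a < 2" "a \<noteq> 1"
  shows "cos (pi * a / 2) \<noteq> 0"
proof
  assume "cos (pi * a / 2) = 0"
  then have "cos (pi * a / 2) = cos (pi / 2)" by simp
  then have "pi * a / 2 = pi / 2"
    by (rule cos_inj_pi[rotated 4]) (use assms in auto)
  with assms show False by simp
qed

text \<open>The limits are taken along sequences, so that the dominated convergence theorem applies.\<close>

context
  fixes a t :: real and e1 e2 :: "nat \<Rightarrow> real"
  assumes a: "1 / 2 < a" "a < 2" "a \<noteq> 1" and t: "t > 0"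
    and e1: "\<And>n. 0 < e1 n" "\<And>n. e1 n \<le> 1" "e1 \<longlonglongrightarrow> 0"
    and e2: "\<And>n. 0 < e2 n" "\<And>n. e2 n \<le> 1" "e2 \<longlonglongrightarrow> 0"
    and ratio: "\<And>n. e2 n \<le> 2 * e1 n"
begin

lemma eps_nonneg: "0 \<le> e1 n" "0 \<le> e2 n"
  using e1(1) e2(1) less_imp_le by auto

lemma cos_nonzero: "cos (pi * a / 2) \<noteq> 0"
  using cos_pi_half_nonzero[of a] a by simp

text \<open>Here \<open>half_var'\<close> behaves like \<open>s powr (a - 1)\<close>, which is integrable for every positive \<open>a\<close>, and its
  cofactor stays bounded. The limiting integrand \<open>x powr a * (a / 2) * (x powr (a - 1) + (t - x) powr (a - 1))\<close> produces the Beta function.\<close>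

lemma cross_term_limit:
  "(\<lambda>n. integral {0..t} (\<lambda>x. (2 * half_var a (e2 n) x - half_var a (e2 n) 0) *
      (half_var' a (e1 n) x - half_var' a (e1 n) (x - t)))) \<longlonglongrightarrow>
   t powr (2 * a) * (1 / 4 + a / 2 * Beta (a + 1) a)"
proof -
  define c where "c = 2 * \<bar>cos (pi * a / 2)\<bar>"
  have c: "c > 0" using cos_nonzero by (simp add: c_def)
  define K0 where "K0 = (1 + t) powr a / c"
  define K1 where "K1 = (1 + t) powr (a - 1)"
  define F where "F n x = (2 * half_var a (e2 n) x - half_var a (e2 n) 0) *
      (half_var' a (e1 n) x - half_var' a (e1 n) (x - t))" for n x
  define G where "G x = x powr a * (a / 2 * (x powr (a - 1) + (t - x) powr (a - 1)))" for x
  define h where "h x = 3 * K0 * (a * (x powr (a - 1) + K1) / c + a * ((t - x) powr (a - 1) + K1) / c)" for x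
  have b0: "\<bar>half_var a (e2 n) s\<bar> \<le> K0" if "\<bar>s\<bar> \<le> t" for n s
  proof -
    have "\<bar>half_var a (e2 n) s\<bar> \<le> norm (cpow a (e2 n) s) / c"
      unfolding c_def by (rule abs_half_var_le)
    also have "\<dots> \<le> K0" unfolding K0_def
      using norm_cpow_le_nonneg[of "e2 n" s t a] e2(2) eps_nonneg that a c
      by (intro divide_right_mono) auto
    finally show ?thesis .
  qed
  have b1: "\<bar>half_var' a (e1 n) s\<bar> \<le> a * (\<bar>s\<bar> powr (a - 1) + K1) / c" if "\<bar>s\<bar> \<le> t" "s \<noteq> 0" for n s
  proof -
    have "\<bar>half_var' a (e1 n) s\<bar> \<le> \<bar>a\<bar> * norm (cpow (a - 1) (e1 n) s) / c"
      unfolding c_def by (rule abs_half_var_le)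
    also have "\<dots> \<le> a * (\<bar>s\<bar> powr (a - 1) + K1) / c" unfolding K1_def
      using norm_cpow_le[of "e1 n" s t "a - 1"] e1(2) eps_nonneg that a c
      by (intro divide_right_mono mult_mono) auto
    finally show ?thesis .
  qed
  have int_h: "h integrable_on {0<..<t}"
    unfolding h_def integrable_on_Icc_iff_Ioo[symmetric]
  proof -
    have 1: "(\<lambda>x. x powr (a - 1)) integrable_on {0..t}"
      using a t by (intro integrable_on_powr_from_0) auto
    then have 2: "(\<lambda>x. (t - x) powr (a - 1)) integrable_on {0..t}"
      by (rule has_integral_integrable[OF has_integral_reflect_Icc[OF integrable_integral]])
    show "(\<lambda>x. 3 * K0 * (a * (x powr (a - 1) + K1) / c + a * ((t - x) powr (a - 1) + K1) / c))
        integrable_on {0..t}"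
      by (intro integrable_on_mult_right Henstock_Kurzweil_Integration.integrable_add integrable_on_divide 1 2 integrable_const_ivl)
  qed
  have e20: "(\<lambda>n. half_var a (e2 n) 0) \<longlonglongrightarrow> 0"
  proof -
    have "(\<lambda>n. cpow a (e2 n) 0) \<longlonglongrightarrow> 0"
      unfolding cpow_def using a
      by (intro tendsto_powr_complex_0[where b="complex_of_real a"] tendsto_const)
        (use tendsto_of_real[OF e2(3)] in simp_all)
    then have "(\<lambda>n. half_var a (e2 n) 0) \<longlonglongrightarrow> Re 0 / (2 * cos (pi * a / 2))"
      unfolding half_var_def by (intro tendsto_intros) (use cos_nonzero in auto)
    then show ?thesis by simp
  qed
  have lim: "(\<lambda>n. integral {0<..<t} (F n)) \<longlonglongrightarrow> integral {0<..<t} G"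
  proof (rule dominated_convergence(2)[OF _ int_h])
    show "F n integrable_on {0<..<t}" for n
    proof -
      have "continuous_on {0..t} (\<lambda>x. half_var' a (e1 n) (x - t))"
        by (rule continuous_on_compose2[OF continuous_on_half_var(2)[OF e1(1), of UNIV]])
          (auto intro!: continuous_intros)
      then show ?thesis
        unfolding integrable_on_Icc_iff_Ioo[symmetric] F_def
        by (intro integrable_continuous_interval continuous_intros continuous_on_half_var e1 e2)
    qed
    show "norm (F n x) \<le> h x" if x: "x \<in> {0<..<t}" for n x
    proof -
      have "\<bar>2 * half_var a (e2 n) x - half_var a (e2 n) 0\<bar> \<le> 3 * K0"
        using b0[of x n] b0[of 0 n] x unfolding abs_le_iff by simp
      moreover have "\<bar>half_var' a (e1 n) x - half_var' a (e1 n) (x - t)\<bar> \<le>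
          a * (x powr (a - 1) + K1) / c + a * ((t - x) powr (a - 1) + K1) / c"
        using b1[of x n] b1[of "x - t" n] x abs_triangle_ineq4[of "half_var' a (e1 n) x" "half_var' a (e1 n) (x - t)"]
        by simp
      ultimately show ?thesis
        unfolding F_def h_def real_norm_def abs_mult by (intro mult_mono) auto
    qed
    show "(\<lambda>n. F n x) \<longlonglongrightarrow> G x" if x: "x \<in> {0<..<t}" for x
    proof -
      have odd: "half_var' a (e1 n) (x - t) = - half_var' a (e1 n) (t - x)" for n
        using half_var_minus(2)[of "e1 n" a "t - x"] e1 by simp
      have "(\<lambda>n. F n x) \<longlonglongrightarrow> (2 * (x powr a / 2) - 0) *
          (a / 2 * x powr (a - 1) - - (a / 2 * (t - x) powr (a - 1)))"
        unfolding F_def odd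
        by (intro tendsto_intros tendsto_half_var e20 e1 e2 cos_nonzero) (use x in auto)
      then show ?thesis by (simp add: G_def distrib_left)
    qed
  qed
  have G: "(G has_integral t powr (2 * a) * (1 / 4 + a / 2 * Beta (a + 1) a)) {0..t}"
  proof -
    have 1: "((\<lambda>x. x powr (2 * a - 1)) has_integral t powr (2 * a) / (2 * a)) {0..t}"
      using has_integral_powr_from_0[of "2 * a - 1" t] a t by simp
    have 2: "((\<lambda>x. x powr a * (t - x) powr (a - 1)) has_integral t powr (2 * a) * Beta (a + 1) a) {0..t}"
      using has_integral_Beta_scaled[of t a "a - 1"] a t by simp
    have "((\<lambda>x. a / 2 * (x powr (2 * a - 1) + x powr a * (t - x) powr (a - 1))) has_integral
       a / 2 * (t powr (2 * a) / (2 * a) + t powr (2 * a) * Beta (a + 1) a)) {0..t}"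
      by (intro has_integral_mult_right has_integral_add 1 2)
    moreover have "(\<lambda>x. a / 2 * (x powr (2 * a - 1) + x powr a * (t - x) powr (a - 1))) = G"
      unfolding G_def by (simp add: fun_eq_iff distrib_left mult_ac flip: powr_add)
    moreover have "a / 2 * (t powr (2 * a) / (2 * a) + t powr (2 * a) * Beta (a + 1) a) =
        t powr (2 * a) * (1 / 4 + a / 2 * Beta (a + 1) a)"
      using a by (simp add: distrib_left)
    ultimately show ?thesis by (simp only:)
  qed
  show ?thesis using lim
    unfolding F_def integral_open_interval_real[symmetric] integral_unique[OF G] .
qed

text \<open>The integrand is bounded by a multiple of \<open>s powr (2 * a - 2)\<close> plus a constant, and \<open>2 * a - 2 > -1\<close> is
  precisely the condition \<open>\<alpha> > 1/4\<close>. Dominated convergence is used for the inner integral first, and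
  then for the outer one with the integrated bound as majorant.\<close>

lemma diagonal_term_limit:
  "(\<lambda>n. integral {0..t} (\<lambda>x. integral {0..x} (\<lambda>s. half_var'' a (e1 n) s * half_var a (e2 n) s))) \<longlonglongrightarrow>
     t powr (2 * a) * ((a - 1) / (8 * (2 * a - 1)))"
proof -
  define c where "c = 2 * \<bar>cos (pi * a / 2)\<bar>"
  have c: "c > 0" using cos_nonzero by (simp add: c_def)
  define K where "K = \<bar>a * (1 - a)\<bar> / c * (2 powr a / c)"
  have K: "K \<ge> 0" using c by (simp add: K_def)
  define T where "T = (1 + t) powr (2 * a - 2)"
  define \<phi> where "\<phi> n s = half_var'' a (e1 n) s * half_var a (e2 n) s" for n s
  define \<psi> where "\<psi> s = a * (a - 1) / 4 * s powr (2 * a - 2)" for s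
  define h where "h s = K * (s powr (2 * a - 2) + T)" for s
  define H where "H x = K * (x powr (2 * a - 1) / (2 * a - 1) + x * T)" for x
  have bound: "\<bar>\<phi> n s\<bar> \<le> h s" if "0 < s" "s \<le> t" for n s
  proof -
    let ?n = "\<lambda>p e. norm (cpow p (e n) s)"
    have "\<bar>\<phi> n s\<bar> \<le> (\<bar>a * (1 - a)\<bar> * ?n (a - 2) e1 / c) * (?n a e2 / c)"
      unfolding \<phi>_def abs_mult[of "half_var'' a (e1 n) s"] c_def by (intro mult_mono abs_half_var_le) auto
    also have "\<dots> = \<bar>a * (1 - a)\<bar> / c / c * (?n (a - 2) e1 * ?n a e2)"
      by simp
    also have "\<dots> \<le> \<bar>a * (1 - a)\<bar> / c / c * (2 powr a * ?n (a - 2 + a) e1)"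
      using eps_nonneg ratio a that c by (intro mult_left_mono norm_cpow_mult_le) auto
    also have "\<dots> = K * ?n (2 * a - 2) e1"
      by (simp add: K_def)
    also have "\<dots> \<le> h s"
      unfolding h_def T_def using norm_cpow_le[of "e1 n" s t "2 * a - 2"] e1(2) eps_nonneg that K
      by (intro mult_left_mono) auto
    finally show ?thesis .
  qed
  have int_h: "(h has_integral H x) {0..x}" if "0 \<le> x" for x
  proof -
    have "((\<lambda>s. s powr (2 * a - 2)) has_integral x powr (2 * a - 1) / (2 * a - 1)) {0..x}"
      using has_integral_powr_from_0[of "2 * a - 2" x] a that by simp
    moreover have "((\<lambda>s. T) has_integral x * T) {0..x}"
      using has_integral_const_real[of T 0 x] that by simp
    ultimately show ?thesis
      unfolding h_def H_def by (intro has_integral_mult_right has_integral_add)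
  qed
  have int_\<psi>: "(\<psi> has_integral a * (a - 1) / 4 * (x powr (2 * a - 1) / (2 * a - 1))) {0..x}" if "0 \<le> x" for x
    unfolding \<psi>_def using has_integral_powr_from_0[of "2 * a - 2" x] a that
    by (intro has_integral_mult_right) simp
  have int_\<phi>: "\<phi> n integrable_on {0..x}" for n x
    unfolding \<phi>_def
    by (intro integrable_continuous_interval continuous_intros continuous_on_half_var) (use e1 e2 in auto)
  have lim_\<phi>: "(\<lambda>n. \<phi> n s) \<longlonglongrightarrow> \<psi> s" if "0 < s" for s
  proof -
    have "(\<lambda>n. \<phi> n s) \<longlonglongrightarrow> (a * (a - 1) / 2 * s powr (a - 2)) * (s powr a / 2)"
      unfolding \<phi>_def by (intro tendsto_intros tendsto_half_var that e1 e2 cos_nonzero)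
    moreover have "(a * (a - 1) / 2 * s powr (a - 2)) * (s powr a / 2) = \<psi> s"
      by (simp add: \<psi>_def field_simps flip: powr_add)
    ultimately show ?thesis by simp
  qed
  have inner: "(\<lambda>n. integral {0..x} (\<phi> n)) \<longlonglongrightarrow> a * (a - 1) / 4 * (x powr (2 * a - 1) / (2 * a - 1))"
    if x: "x \<in> {0..t}" for x
  proof -
    have "(\<lambda>n. integral {0<..<x} (\<phi> n)) \<longlonglongrightarrow> integral {0<..<x} \<psi>"
    proof (rule dominated_convergence(2))
      show "\<phi> n integrable_on {0<..<x}" for n
        using int_\<phi> by (simp add: integrable_on_Icc_iff_Ioo[symmetric])
      show "h integrable_on {0<..<x}"
        using int_h[of x] x by (auto simp: integrable_on_Icc_iff_Ioo[symmetric])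
    qed (use bound lim_\<phi> x in auto)
    then show ?thesis
      unfolding integral_open_interval_real[symmetric] using integral_unique[OF int_\<psi>[of x]] x by simp
  qed
  have "(\<lambda>n. integral {0..t} (\<lambda>x. integral {0..x} (\<phi> n))) \<longlonglongrightarrow>
      integral {0..t} (\<lambda>x. a * (a - 1) / 4 * (x powr (2 * a - 1) / (2 * a - 1)))"
  proof (rule dominated_convergence(2))
    show "(\<lambda>x. integral {0..x} (\<phi> n)) integrable_on {0..t}" for n
      by (intro integrable_continuous_interval indefinite_integral_continuous_1 int_\<phi>)
    show "H integrable_on {0..t}"
      unfolding H_def
      by (intro integrable_on_mult_right Henstock_Kurzweil_Integration.integrable_add
          integrable_on_divide integrable_on_powr_from_0
          integrable_on_mult_left ident_integrable_on) (use a t in auto)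
    show "norm (integral {0..x} (\<phi> n)) \<le> H x" if x: "x \<in> {0..t}" for n x
    proof -
      have "norm (integral {0<..<x} (\<phi> n)) \<le> integral {0<..<x} h"
      proof (rule integral_norm_bound_integral)
        show "\<phi> n integrable_on {0<..<x}"
          using int_\<phi> by (simp add: integrable_on_Icc_iff_Ioo[symmetric])
        show "h integrable_on {0<..<x}"
          using int_h[of x] x by (auto simp: integrable_on_Icc_iff_Ioo[symmetric])
      qed (use bound x in auto)
      then show ?thesis
        unfolding integral_open_interval_real[symmetric] using integral_unique[OF int_h[of x]] x by simp
    qed
  qed (use inner in auto)
  also have "integral {0..t} (\<lambda>x. a * (a - 1) / 4 * (x powr (2 * a - 1) / (2 * a - 1))) =
      a * (a - 1) / 4 * (t powr (2 * a) / (2 * a) / (2 * a - 1))"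
    using has_integral_powr_from_0[of "2 * a - 1" t] a t
    by (intro integral_unique has_integral_mult_right has_integral_divide) auto
  also have "\<dots> = t powr (2 * a) * ((a - 1) / (8 * (2 * a - 1)))"
    using a by (simp add: field_simps)
  finally show ?thesis unfolding \<phi>_def .
qed

end

section \<open>Second moments of iterated integrals of random paths\<close>

text \<open>Joint measurability, without which Fubini's theorem cannot be used, holds because a continuous path is
  the pointwise limit of its discretisations to the grids of mesh \<open>1 / n\<close>, and these take only countably many
  random variables into account.\<close>

lemma borel_measurable_continuous_paths:
  fixes X :: "real \<Rightarrow> 'a \<Rightarrow> real"
  assumes [measurable]: "\<And>x. X x \<in> borel_measurable M"
    and cont: "\<And>\<omega>. \<omega> \<in> space M \<Longrightarrow> continuous_on UNIV (\<lambda>x. X x \<omega>)"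
  shows "(\<lambda>(\<omega>, x). X x \<omega>) \<in> borel_measurable (M \<Otimes>\<^sub>M borel)"
proof -
  define r where "r n x = real_of_int \<lfloor>real (Suc n) * x\<rfloor> / real (Suc n)" for n and x :: real
  have r: "(\<lambda>n. r n x) \<longlonglongrightarrow> x" for x
  proof -
    have "(\<lambda>n. r n x - x) \<longlonglongrightarrow> 0"
    proof (rule Lim_null_comparison[OF always_eventually LIMSEQ_inverse_real_of_nat], intro allI)
      fix n
      have "\<bar>real_of_int \<lfloor>real (Suc n) * x\<rfloor> - real (Suc n) * x\<bar> \<le> 1"
        by linarith
      moreover have "r n x - x = (real_of_int \<lfloor>real (Suc n) * x\<rfloor> - real (Suc n) * x) / real (Suc n)"
        by (simp add: r_def field_simps)
      ultimately show "norm (r n x - x) \<le> inverse (real (Suc n))"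
        by (simp only: real_norm_def abs_divide abs_of_nat inverse_eq_divide divide_right_mono of_nat_0_le_iff)
    qed
    then show ?thesis by (rule LIM_zero_cancel)
  qed
  show ?thesis
  proof (rule borel_measurable_LIMSEQ_real)
    show "(\<lambda>p. X (r n (snd p)) (fst p)) \<in> borel_measurable (M \<Otimes>\<^sub>M borel)" for n
    proof -
      have "(\<lambda>p. (\<lambda>k p. X (real_of_int k / real (Suc n)) (fst p)) \<lfloor>real (Suc n) * snd p\<rfloor> p)
          \<in> borel_measurable (M \<Otimes>\<^sub>M borel)"
        by (rule measurable_compose_countable) measurable
      then show ?thesis by (simp add: r_def)
    qed
    show "(\<lambda>n. X (r n (snd p)) (fst p)) \<longlonglongrightarrow> (case p of (\<omega>, x) \<Rightarrow> X x \<omega>)"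
      if "p \<in> space (M \<Otimes>\<^sub>M borel)" for p
      using continuous_on_tendsto_compose[OF cont[of "fst p"] r[of "snd p"]] that
      by (auto simp: space_pair_measure split_beta)
  qed
qed

lemma borel_measurable_completion_AE_eq:
  assumes f: "f \<in> borel_measurable M" and ae: "AE x in M. f x = g x"
  shows "g \<in> borel_measurable (completion M)"
proof (rule measurableI)
  fix A :: "'b set" assume "A \<in> sets borel"
  show "g -` A \<inter> space (completion M) \<in> sets (completion M)"
  proof (rule completion.in_sets_AE)
    show "f -` A \<inter> space (completion M) \<in> sets (completion M)"
      using measurable_sets[OF measurable_completion[OF f] \<open>A \<in> sets borel\<close>] .
    show "AE x in completion M. x \<in> f -` A \<inter> space (completion M) \<longleftrightarrow> x \<in> g -` A \<inter> space (completion M)"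
      using AE_completion[OF ae] by eventually_elim simp
  qed auto
qed simp

text \<open>The square of the integral is a double integral over two copies of the parameter, and the
  expectation moves inside by Fubini's theorem. Absolute integrability follows from a uniform bound on
  the second moments together with \<open>\<bar>a b\<bar> \<le> a\<^sup>2 + b\<^sup>2\<close>.\<close>

lemma second_moment_integral:
  fixes Z :: "'b \<Rightarrow> 'a \<Rightarrow> real"
  assumes "prob_space M" "finite_measure N"
    and Z [measurable]: "(\<lambda>(\<omega>, p). Z p \<omega>) \<in> borel_measurable (M \<Otimes>\<^sub>M N)"
    and sq: "\<And>p. p \<in> space N \<Longrightarrow> integrable M (\<lambda>\<omega>. (Z p \<omega>)\<^sup>2)"
      "\<And>p. p \<in> space N \<Longrightarrow> (LINT \<omega>|M. (Z p \<omega>)\<^sup>2) \<le> B"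
  shows "(\<lambda>\<omega>. LINT p|N. Z p \<omega>) \<in> borel_measurable M"
    and "(LINT \<omega>|M. (LINT p|N. Z p \<omega>)\<^sup>2) = (LINT p|N. LINT q|N. LINT \<omega>|M. Z p \<omega> * Z q \<omega>)"
proof -
  interpret M: prob_space M by fact
  interpret N: finite_measure N by fact
  interpret NN: pair_sigma_finite N N ..
  interpret NN': finite_measure "N \<Otimes>\<^sub>M N"
    by (rule finite_measure_pair_measure) fact+
  interpret P: pair_sigma_finite "N \<Otimes>\<^sub>M N" M ..
  show meas [measurable]: "(\<lambda>\<omega>. LINT p|N. Z p \<omega>) \<in> borel_measurable M"
    by measurable
  define F where "F p \<omega> = Z (fst p) \<omega> * Z (snd p) \<omega>" for p \<omega>
  have F [measurable]: "case_prod F \<in> borel_measurable ((N \<Otimes>\<^sub>M N) \<Otimes>\<^sub>M M)"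
    unfolding F_def by measurable
  have F_bound: "\<bar>F p \<omega>\<bar> \<le> (Z (fst p) \<omega>)\<^sup>2 + (Z (snd p) \<omega>)\<^sup>2" for p \<omega>
    unfolding F_def using sum_squares_bound[of "\<bar>Z (fst p) \<omega>\<bar>" "\<bar>Z (snd p) \<omega>\<bar>"]
      mult_nonneg_nonneg[OF abs_ge_zero[of "Z (fst p) \<omega>"] abs_ge_zero[of "Z (snd p) \<omega>"]]
    by (simp only: abs_mult power2_abs mult.assoc)
  have int_F: "integrable M (F p)" if p: "p \<in> space (N \<Otimes>\<^sub>M N)" for p
  proof (rule Bochner_Integration.integrable_bound)
    show "integrable M (\<lambda>\<omega>. (Z (fst p) \<omega>)\<^sup>2 + (Z (snd p) \<omega>)\<^sup>2)"
      using p by (intro Bochner_Integration.integrable_add sq) (auto simp: space_pair_measure)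
    show "F p \<in> borel_measurable M" using p by measurable
  qed (use F_bound in auto)
  have int: "integrable ((N \<Otimes>\<^sub>M N) \<Otimes>\<^sub>M M) (case_prod F)"
  proof (rule P.Fubini_integrable[OF F])
    show "integrable (N \<Otimes>\<^sub>M N) (\<lambda>p. LINT \<omega>|M. norm (case (p, \<omega>) of (p, \<omega>) \<Rightarrow> F p \<omega>))"
    proof (rule NN'.integrable_const_bound[where B = "2 * B"])
      show "AE p in N \<Otimes>\<^sub>M N. norm (LINT \<omega>|M. norm (case (p, \<omega>) of (p, \<omega>) \<Rightarrow> F p \<omega>)) \<le> 2 * B"
      proof (rule AE_I2)
        fix p assume p: "p \<in> space (N \<Otimes>\<^sub>M N)"
        have p': "fst p \<in> space N" "snd p \<in> space N"
          using p by (auto simp: space_pair_measure)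
        have "(LINT \<omega>|M. norm (F p \<omega>)) \<le> (LINT \<omega>|M. (Z (fst p) \<omega>)\<^sup>2 + (Z (snd p) \<omega>)\<^sup>2)"
          by (intro integral_mono integrable_norm int_F p Bochner_Integration.integrable_add sq p')
            (use F_bound in simp)
        also have "\<dots> \<le> 2 * B"
          using sq(2)[OF p'(1)] sq(2)[OF p'(2)] sq(1)[OF p'(1)] sq(1)[OF p'(2)] by simp
        finally show "norm (LINT \<omega>|M. norm (case (p, \<omega>) of (p, \<omega>) \<Rightarrow> F p \<omega>)) \<le> 2 * B"
          by simp
      qed
    qed measurable
    show "AE p in N \<Otimes>\<^sub>M N. integrable M (\<lambda>\<omega>. case (p, \<omega>) of (p, \<omega>) \<Rightarrow> F p \<omega>)"
      using int_F by (intro AE_I2) simp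
  qed
  have "(LINT \<omega>|M. (LINT p|N. Z p \<omega>)\<^sup>2) = (LINT \<omega>|M. LINT p|(N \<Otimes>\<^sub>M N). F p \<omega>)"
  proof (rule integral_cong_AE)
    show "AE \<omega> in M. (LINT p|N. Z p \<omega>)\<^sup>2 = (LINT p|(N \<Otimes>\<^sub>M N). F p \<omega>)"
      using P.AE_integrable_snd[OF int]
    proof eventually_elim
      fix \<omega> assume *: "integrable (N \<Otimes>\<^sub>M N) (\<lambda>p. F p \<omega>)"
      have "(LINT p|N. Z p \<omega>)\<^sup>2 = (LINT p|N. LINT q|N. F (p, q) \<omega>)"
        by (simp add: F_def power2_eq_square)
      then show "(LINT p|N. Z p \<omega>)\<^sup>2 = (LINT p|(N \<Otimes>\<^sub>M N). F p \<omega>)"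
        using NN.integral_fst'[OF *] by simp
    qed
  qed measurable
  also have "\<dots> = (LINT p|(N \<Otimes>\<^sub>M N). LINT \<omega>|M. F p \<omega>)"
    by (rule P.Fubini_integral[OF int])
  also have "\<dots> = (LINT p|N. LINT q|N. LINT \<omega>|M. F (p, q) \<omega>)"
    by (rule NN.integral_fst'[symmetric]) (rule P.integrable_fst[OF int])
  finally show "(LINT \<omega>|M. (LINT p|N. Z p \<omega>)\<^sup>2) = (LINT p|N. LINT q|N. LINT \<omega>|M. Z p \<omega> * Z q \<omega>)"
    by (simp add: F_def)
qed

text \<open>The iterated integral is written as one integral with respect to a finite product measure, so that
  the previous lemma applies to it; the evaluation of the outcome is done with Henstock-Kurzweil integrals.\<close>

lemma integral_triangle:
  fixes f :: "real \<Rightarrow> real \<Rightarrow> real" and t :: real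
  defines "L \<equiv> restrict_space lborel {0..t}"
  assumes f: "continuous_on UNIV (\<lambda>(x, u). f x u)"
  shows "(LINT p|(L \<Otimes>\<^sub>M L). indicator {..fst p} (snd p) * f (fst p) (snd p)) =
      (LBINT x:{0..t}. LBINT u:{0..x}. f x u)" (is ?A)
    and "(LBINT x:{0..t}. LBINT u:{0..x}. f x u) = integral {0..t} (\<lambda>x. integral {0..x} (f x))" (is ?B)
proof -
  interpret L: finite_measure L
    unfolding L_def by (rule finite_measureI) (simp add: emeasure_restrict_space space_restrict_space emeasure_lborel_Icc_eq)
  interpret LL: pair_sigma_finite L L ..
  interpret LL': finite_measure "L \<Otimes>\<^sub>M L"
    by (rule finite_measure_pair_measure) unfold_locales
  have space: "space L = {0..t}" by (simp add: L_def space_restrict_space)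
  have id [measurable]: "(\<lambda>x. x) \<in> L \<rightarrow>\<^sub>M borel"
    unfolding L_def by (rule measurable_restrict_space1) simp
  have [measurable]: "(\<lambda>p. f (fst p) (snd p)) \<in> borel_measurable (borel \<Otimes>\<^sub>M borel)"
    unfolding borel_prod using borel_measurable_continuous_onI[OF f] by (simp add: case_prod_beta')
  let ?h = "\<lambda>p. indicator {..fst p} (snd p) * f (fst p) (snd p)"
  obtain B where B: "\<And>p. p \<in> {0..t} \<times> {0..t} \<Longrightarrow> norm (f (fst p) (snd p)) \<le> B"
  proof -
    have "compact ((\<lambda>p. f (fst p) (snd p)) ` ({0..t} \<times> {0..t}))"
      using f by (intro compact_continuous_image compact_Times)
        (auto simp: split_beta intro: continuous_on_subset)
    then show ?thesis using that unfolding bounded_iff[symmetric]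
      by (meson compact_imp_bounded bounded_iff imageI)
  qed
  have meas: "?h \<in> borel_measurable (L \<Otimes>\<^sub>M L)"
  proof -
    have 1: "(\<lambda>p. (fst p, snd p)) \<in> L \<Otimes>\<^sub>M L \<rightarrow>\<^sub>M (borel \<Otimes>\<^sub>M borel :: (real \<times> real) measure)"
      by (intro measurable_Pair measurable_compose[OF measurable_fst id] measurable_compose[OF measurable_snd id])
    have "?h \<in> borel_measurable (borel \<Otimes>\<^sub>M borel :: (real \<times> real) measure)"
      unfolding indicator_def atMost_iff by measurable
    from measurable_compose[OF 1 this] show ?thesis by simp
  qed
  have int: "integrable (L \<Otimes>\<^sub>M L) ?h"
  proof (rule LL'.integrable_const_bound[OF _ meas])
    show "AE p in L \<Otimes>\<^sub>M L. norm (?h p) \<le> \<bar>B\<bar>"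
      using B by (intro AE_I2) (fastforce simp: space_pair_measure space indicator_def)
  qed
  have inner: "(LINT u|L. ?h (x, u)) = (LBINT u:{0..x}. f x u)" if "x \<in> {0..t}" for x
  proof -
    have "(LINT u|L. ?h (x, u)) = (LINT u|lborel. indicator {0..t} u *\<^sub>R ?h (x, u))"
      unfolding L_def by (rule integral_restrict_space) simp
    also have "\<dots> = (LBINT u:{0..x}. f x u)"
      unfolding set_lebesgue_integral_def using that
      by (intro Bochner_Integration.integral_cong) (auto simp: indicator_def)
    finally show ?thesis .
  qed
  have "(LINT p|(L \<Otimes>\<^sub>M L). ?h p) = (LINT x|L. LINT u|L. ?h (x, u))"
    by (rule LL.integral_fst'[OF int, symmetric])
  also have "\<dots> = (LINT x|L. (LBINT u:{0..x}. f x u))"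
    by (intro Bochner_Integration.integral_cong inner) (auto simp: space)
  also have "\<dots> = (LBINT x:{0..t}. LBINT u:{0..x}. f x u)"
    unfolding L_def set_lebesgue_integral_def by (rule integral_restrict_space) simp
  finally show ?A .
  have "integrable L (\<lambda>x. LINT u|L. ?h (x, u))"
    by (rule LL.integrable_fst'[OF int])
  also have "?this \<longleftrightarrow> integrable L (\<lambda>x. LBINT u:{0..x}. f x u)"
    by (intro Bochner_Integration.integrable_cong inner) (auto simp: space)
  finally have "set_integrable lborel {0..t} (\<lambda>x. LBINT u:{0..x}. f x u)"
    unfolding L_def set_integrable_def by (subst (asm) integrable_restrict_space) auto
  then have "(LBINT x:{0..t}. LBINT u:{0..x}. f x u) = integral {0..t} (\<lambda>x. LBINT u:{0..x}. f x u)"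
    by (rule set_borel_integral_eq_integral)
  also have "\<dots> = integral {0..t} (\<lambda>x. integral {0..x} (f x))"
  proof (intro Henstock_Kurzweil_Integration.integral_cong set_borel_integral_eq_integral
      borel_integrable_atLeastAtMost')
    show "continuous_on {0..x} (f x)" for x
    proof -
      have "continuous_on {0..x} (\<lambda>u. (x, u))" by (intro continuous_intros)
      from continuous_on_compose2[OF f this] show ?thesis by simp
    qed
  qed
  finally show ?B .
qed

text \<open>The paths are continuous off a null set only. The processes are set to zero there, which makes all paths
  continuous and changes neither the moments nor, up to that null set, the iterated integral. The
  iterated integral itself is thereby measurable for the completion of \<open>M\<close>. The primitive \<open>l1\<close>
  serves to see that the inner double integral is continuous in the remaining two variables.\<close>

lemma second_moment_iterated_integral:
  fixes X Y :: "real \<Rightarrow> 'a \<Rightarrow> real" and k l l1 :: "real \<Rightarrow> real"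
  assumes M: "prob_space M"
    and meas [measurable]: "\<And>x. X x \<in> borel_measurable M" "\<And>x. Y x \<in> borel_measurable M"
    and cont: "AE \<omega> in M. continuous_on UNIV (\<lambda>x. X x \<omega>)" "AE \<omega> in M. continuous_on UNIV (\<lambda>x. Y x \<omega>)"
    and kl: "continuous_on UNIV k" "continuous_on UNIV l"
    and l1: "\<And>s. (l1 has_real_derivative l s) (at s)"
    and int: "\<And>x y u v. integrable M (\<lambda>\<omega>. (X x \<omega> * Y u \<omega>) * (X y \<omega> * Y v \<omega>))"
    and moment: "\<And>x y u v. (LINT \<omega>|M. (X x \<omega> * Y u \<omega>) * (X y \<omega> * Y v \<omega>)) = k (x - y) * l (u - v)"
  shows "(LINT \<omega>|completion M. (LBINT x:{0..t}. X x \<omega> * (LBINT u:{0..x}. Y u \<omega>))\<^sup>2) =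
    integral {0..t} (\<lambda>x. integral {0..x} (\<lambda>u. integral {0..t} (\<lambda>y. integral {0..y} (\<lambda>v.
      k (x - y) * l (u - v)))))"
proof -
  interpret prob_space M by fact
  obtain N where N: "N \<in> null_sets M"
    and contN: "\<And>\<omega>. \<omega> \<in> space M - N \<Longrightarrow>
      continuous_on UNIV (\<lambda>x. X x \<omega>) \<and> continuous_on UNIV (\<lambda>x. Y x \<omega>)"
  proof -
    from cont have "AE \<omega> in M. continuous_on UNIV (\<lambda>x. X x \<omega>) \<and> continuous_on UNIV (\<lambda>x. Y x \<omega>)"
      by eventually_elim simp
    then show ?thesis using that by (elim AE_E) (auto simp: null_sets_def)
  qed
  have [measurable]: "N \<in> sets M" using N by auto
  have aeN: "AE \<omega> in M. \<omega> \<notin> N" using N by (rule AE_not_in)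
  define X' where "X' x \<omega> = indicator (- N) \<omega> * X x \<omega>" for x \<omega>
  define Y' where "Y' x \<omega> = indicator (- N) \<omega> * Y x \<omega>" for x \<omega>
  have [measurable]: "X' x \<in> borel_measurable M" "Y' x \<in> borel_measurable M" for x
    unfolding X'_def Y'_def indicator_def by measurable
  have cont': "continuous_on UNIV (\<lambda>x. X' x \<omega>)" "continuous_on UNIV (\<lambda>x. Y' x \<omega>)"
    if "\<omega> \<in> space M" for \<omega>
    using contN[of \<omega>] that by (cases "\<omega> \<in> N"; simp add: X'_def Y'_def)+
  have joint: "(\<lambda>(\<omega>, x). X' x \<omega>) \<in> borel_measurable (M \<Otimes>\<^sub>M borel)"
    "(\<lambda>(\<omega>, x). Y' x \<omega>) \<in> borel_measurable (M \<Otimes>\<^sub>M borel)"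
    by (intro borel_measurable_continuous_paths cont'; simp)+
  define L where "L = restrict_space lborel {0..t}"
  have L: "finite_measure L"
    unfolding L_def by (rule finite_measureI) (simp add: emeasure_restrict_space space_restrict_space emeasure_lborel_Icc_eq)
  define Z where "Z p \<omega> = indicator {..fst p} (snd p) * (X' (fst p) \<omega> * Y' (snd p) \<omega>)" for p :: "real \<times> real" and \<omega>
  have Z_AE: "AE \<omega> in M. Z p \<omega> * Z q \<omega> =
      indicator {..fst p} (snd p) * (indicator {..fst q} (snd q) *
       ((X (fst p) \<omega> * Y (snd p) \<omega>) * (X (fst q) \<omega> * Y (snd q) \<omega>)))" for p q
    using aeN by eventually_elim (simp add: Z_def X'_def Y'_def)
  have measZ [measurable]: "Z p \<in> borel_measurable M" for p
    unfolding Z_def by measurable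
  have Z_moment: "(LINT \<omega>|M. Z p \<omega> * Z q \<omega>) = indicator {..fst p} (snd p) *
     (indicator {..fst q} (snd q) * (k (fst p - fst q) * l (snd p - snd q)))" for p q
    using integral_cong_AE[OF _ _ Z_AE[of p q]] by (simp add: moment)
  have Z_int: "integrable M (\<lambda>\<omega>. Z p \<omega> * Z q \<omega>)" for p q
    using integrable_cong_AE[OF _ _ Z_AE[of p q]] by (simp add: int)
  have Z_meas: "(\<lambda>(\<omega>, p). Z p \<omega>) \<in> borel_measurable (M \<Otimes>\<^sub>M (L \<Otimes>\<^sub>M L))"
  proof -
    have id: "(\<lambda>x. x) \<in> L \<rightarrow>\<^sub>M borel"
      unfolding L_def by (rule measurable_restrict_space1) simp
    have 1: "(\<lambda>p. (fst p, (fst (snd p), snd (snd p)))) \<in>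
        M \<Otimes>\<^sub>M (L \<Otimes>\<^sub>M L) \<rightarrow>\<^sub>M M \<Otimes>\<^sub>M (borel \<Otimes>\<^sub>M borel :: (real \<times> real) measure)"
      by (intro measurable_Pair measurable_fst measurable_compose[OF _ id]
         measurable_compose[OF measurable_snd measurable_fst] measurable_compose[OF measurable_snd measurable_snd])
    have [measurable]: "(\<lambda>p. X' (fst (snd p)) (fst p)) \<in> borel_measurable (M \<Otimes>\<^sub>M (borel \<Otimes>\<^sub>M borel :: (real \<times> real) measure))"
      "(\<lambda>p. Y' (snd (snd p)) (fst p)) \<in> borel_measurable (M \<Otimes>\<^sub>M (borel \<Otimes>\<^sub>M borel :: (real \<times> real) measure))"
      using measurable_compose[OF _ joint(1), of "\<lambda>p. (fst p, fst (snd p))" "M \<Otimes>\<^sub>M (borel \<Otimes>\<^sub>M borel :: (real \<times> real) measure)"]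
        measurable_compose[OF _ joint(2), of "\<lambda>p. (fst p, snd (snd p))" "M \<Otimes>\<^sub>M (borel \<Otimes>\<^sub>M borel :: (real \<times> real) measure)"]
      by simp_all
    have "(\<lambda>p. Z (snd p) (fst p)) \<in> borel_measurable (M \<Otimes>\<^sub>M (borel \<Otimes>\<^sub>M borel :: (real \<times> real) measure))"
      unfolding Z_def indicator_def atMost_iff by measurable
    from measurable_compose[OF 1 this] show ?thesis by (simp add: split_beta)
  qed
  define \<Phi> where "\<Phi> x u = integral {0..t} (\<lambda>y. integral {0..y} (\<lambda>v. k (x - y) * l (u - v)))" for x u
  have \<Phi>_eq: "\<Phi> x u = integral {0..t} (\<lambda>y. k (x - y) * (l1 u - l1 (u - y)))" for x u
    unfolding \<Phi>_def
  proof (intro Henstock_Kurzweil_Integration.integral_cong)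
    fix y assume "y \<in> {0..t}"
    then have "integral {0..y} (\<lambda>v. l (u - v)) = - l1 (u - y) - (- l1 (u - 0))"
      by (intro integral_Icc_FTC) (auto intro!: derivative_eq_intros DERIV_chain2[OF l1])
    then show "integral {0..y} (\<lambda>v. k (x - y) * l (u - v)) = k (x - y) * (l1 u - l1 (u - y))"
      by simp
  qed
  have cont_\<Phi>: "continuous_on UNIV (\<lambda>(x, u). \<Phi> x u)"
  proof -
    have cl1: "continuous_on UNIV l1"
      using l1 by (meson DERIV_isCont continuous_at_imp_continuous_on)
    have "continuous_on UNIV (\<lambda>p. integral (cbox 0 t) (\<lambda>y. k (fst p - y) * (l1 (snd p) - l1 (snd p - y))))"
      by (rule integral_continuous_on_param, unfold split_beta)
        (intro continuous_intros continuous_on_compose2[OF kl(1)] continuous_on_compose2[OF cl1]; simp)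
    then show ?thesis by (simp add: \<Phi>_eq split_beta)
  qed
  let ?B = "\<bar>k 0 * l 0\<bar>"
  note sm = second_moment_integral[OF M finite_measure_pair_measure[OF L L] Z_meas, of ?B]
  have sq: "integrable M (\<lambda>\<omega>. (Z p \<omega>)\<^sup>2)" "(LINT \<omega>|M. (Z p \<omega>)\<^sup>2) \<le> ?B" for p
    using Z_int[of p p] Z_moment[of p p] by (auto simp: power2_eq_square indicator_def)
  let ?I = "\<lambda>\<omega>. LBINT x:{0..t}. X x \<omega> * (LBINT u:{0..x}. Y u \<omega>)"
  let ?J = "\<lambda>\<omega>. LINT p|(L \<Otimes>\<^sub>M L). Z p \<omega>"
  have J_meas: "?J \<in> borel_measurable M"
    by (rule sm(1)) (use sq in auto)
  have IJ: "AE \<omega> in M. ?J \<omega> = ?I \<omega>"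
    using aeN AE_space
  proof eventually_elim
    fix \<omega> assume \<omega>: "\<omega> \<notin> N" "\<omega> \<in> space M"
    have "?J \<omega> = (LBINT x:{0..t}. LBINT u:{0..x}. X' x \<omega> * Y' u \<omega>)"
      unfolding Z_def L_def
      by (rule integral_triangle(1)) (auto simp: split_beta intro!: continuous_intros
          continuous_on_compose2[OF cont'(1)[OF \<omega>(2)]] continuous_on_compose2[OF cont'(2)[OF \<omega>(2)]])
    then show "?J \<omega> = ?I \<omega>"
      using \<omega> by (simp add: X'_def Y'_def)
  qed
  have "(LINT \<omega>|completion M. (?I \<omega>)\<^sup>2) = (LINT \<omega>|completion M. (?J \<omega>)\<^sup>2)"
  proof (rule integral_cong_AE)
    show "(\<lambda>\<omega>. (?I \<omega>)\<^sup>2) \<in> borel_measurable (completion M)"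
      using borel_measurable_completion_AE_eq[OF J_meas IJ] by measurable
    show "(\<lambda>\<omega>. (?J \<omega>)\<^sup>2) \<in> borel_measurable (completion M)"
      using measurable_completion[OF J_meas] by measurable
    show "AE \<omega> in completion M. (?I \<omega>)\<^sup>2 = (?J \<omega>)\<^sup>2"
      using AE_completion[OF IJ] by eventually_elim simp
  qed
  also have "\<dots> = (LINT \<omega>|M. (?J \<omega>)\<^sup>2)"
    using J_meas by (intro integral_completion) measurable
  also have "\<dots> = (LINT p|(L \<Otimes>\<^sub>M L). LINT q|(L \<Otimes>\<^sub>M L). LINT \<omega>|M. Z p \<omega> * Z q \<omega>)"
    by (rule sm(2)) (use sq in auto)
  also have "\<dots> = (LINT p|(L \<Otimes>\<^sub>M L). indicator {..fst p} (snd p) *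
      (LINT q|(L \<Otimes>\<^sub>M L). indicator {..fst q} (snd q) * (k (fst p - fst q) * l (snd p - snd q))))"
    by (simp add: Z_moment)
  also have "\<dots> = (LINT p|(L \<Otimes>\<^sub>M L). indicator {..fst p} (snd p) * \<Phi> (fst p) (snd p))"
  proof -
    have "(LINT q|(L \<Otimes>\<^sub>M L). indicator {..fst q} (snd q) * (k (x - fst q) * l (u - snd q))) = \<Phi> x u" for x u
    proof -
      have "continuous_on UNIV (\<lambda>(y, v). k (x - y) * l (u - v))"
        unfolding split_beta
        by (intro continuous_intros continuous_on_compose2[OF kl(1)] continuous_on_compose2[OF kl(2)]; simp)
      from integral_triangle[OF this, of t] show ?thesis
        by (simp only: \<Phi>_def L_def)
    qed
    then show ?thesis by simp
  qed
  also have "\<dots> = integral {0..t} (\<lambda>x. integral {0..x} (\<Phi> x))"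
    unfolding L_def using cont_\<Phi> by (simp add: integral_triangle)
  finally show ?thesis unfolding \<Phi>_def .
qed

section \<open>Second moment of the regularised area\<close>

lemma borel_measurable_cnj [measurable]: "cnj \<in> borel_measurable borel"
  by (intro borel_measurable_continuous_onI continuous_intros)

text \<open>Since \<open>\<Gamma>'(\<epsilon>)\<^sub>x = 2 Re (\<Gamma>'\<^sup>+)\<close> at \<open>x + \<i> \<epsilon>\<close>, a product of two values equals
  \<open>2 Re (\<Gamma>'\<^sup>+\<^sub>z \<Gamma>'\<^sup>+\<^sub>w) + 2 Re (\<Gamma>'\<^sup>+\<^sub>z cnj (\<Gamma>'\<^sup>+\<^sub>w))\<close>. The first part has expectation zero, and the base of the power
  in the second one is \<open>- \<i> (z - cnj w) = 2 \<epsilon> - \<i> (x - y)\<close>.\<close>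

lemma fbm_gamma_deriv_moments:
  assumes \<alpha>: "\<alpha> \<in> {0<..<1}" "\<alpha> \<noteq> 1/2" and G: "fbm_gamma_deriv \<alpha> M G" and \<epsilon>: "\<epsilon> > 0"
  shows "integrable M (\<lambda>\<omega>. Gamma_eps_deriv G \<epsilon> x \<omega> * Gamma_eps_deriv G \<epsilon> y \<omega>)"
    and "(LINT \<omega>|M. Gamma_eps_deriv G \<epsilon> x \<omega> * Gamma_eps_deriv G \<epsilon> y \<omega>) =
           half_var'' (2 * \<alpha>) (2 * \<epsilon>) (x - y)"
proof -
  define c where "c = \<alpha> * (1 - 2 * \<alpha>) / (2 * cos (pi * \<alpha>))"
  have "cos (pi * \<alpha>) \<noteq> 0"
    using cos_pi_half_nonzero[of "2 * \<alpha>"] \<alpha> by simp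
  then have c: "c \<noteq> 0" using \<alpha> by (simp add: c_def)
  define z where "z x = Complex x \<epsilon>" for x
  have z: "z x \<in> upper_half_plane" for x
    using \<epsilon> by (simp add: z_def upper_half_plane_def)
  have meas [measurable]: "G (z x) \<in> borel_measurable M" for x
    using G z[of x] by (auto simp: fbm_gamma_deriv_def complex_gaussian_process_def)
  have GG: "(LINT \<omega>|M. G (z x) \<omega> * G (z y) \<omega>) = 0" for x y
    using G z by (auto simp: fbm_gamma_deriv_def)
  have Gcnj: "(LINT \<omega>|M. G (z x) \<omega> * cnj (G (z y) \<omega>)) =
      complex_of_real c * cpow (2 * \<alpha> - 2) (2 * \<epsilon>) (x - y)" for x y
  proof -
    have "- \<i> * (z x - cnj (z y)) = complex_of_real (2 * \<epsilon>) - \<i> * complex_of_real (x - y)"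
      by (simp add: complex_eq_iff z_def)
    moreover have "(LINT \<omega>|M. G (z x) \<omega> * conj_process G (cnj (z y)) \<omega>) =
        complex_of_real c * (- \<i> * (z x - cnj (z y))) powr complex_of_real (2 * \<alpha> - 2)"
      using G z unfolding fbm_gamma_deriv_def c_def by blast
    ultimately show ?thesis
      by (simp only: conj_process_def complex_cnj_cnj cpow_def)
  qed
  \<comment> \<open>A Bochner integral different from zero can only belong to an integrable function, so the
    prescribed covariance itself yields square integrability.\<close>
  have sq: "integrable M (\<lambda>\<omega>. (cmod (G (z x) \<omega>))\<^sup>2)" for x
  proof -
    have "cpow (2 * \<alpha> - 2) (2 * \<epsilon>) 0 \<noteq> 0"
      using \<epsilon> by (simp add: cpow_def)
    then have "(LINT \<omega>|M. G (z x) \<omega> * cnj (G (z x) \<omega>)) \<noteq> 0"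
      using Gcnj[of x x] c by simp
    then have "integrable M (\<lambda>\<omega>. G (z x) \<omega> * cnj (G (z x) \<omega>))"
      using not_integrable_integral_eq by blast
    from integrable_norm[OF this] show ?thesis
      by (simp add: norm_mult power2_eq_square)
  qed
  have bound: "cmod (G (z x) \<omega>) * cmod (G (z y) \<omega>) \<le> (cmod (G (z x) \<omega>))\<^sup>2 + (cmod (G (z y) \<omega>))\<^sup>2" for x y \<omega>
    using sum_squares_bound[of "cmod (G (z x) \<omega>)" "cmod (G (z y) \<omega>)"]
      mult_nonneg_nonneg[OF norm_ge_zero[of "G (z x) \<omega>"] norm_ge_zero[of "G (z y) \<omega>"]]
    by (simp only: mult.assoc)
  have int1: "integrable M (\<lambda>\<omega>. G (z x) \<omega> * G (z y) \<omega>)" for x y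
    by (rule Bochner_Integration.integrable_bound[OF Bochner_Integration.integrable_add[OF sq[of x] sq[of y]]])
      (use bound in \<open>auto simp: norm_mult\<close>)
  have int2: "integrable M (\<lambda>\<omega>. G (z x) \<omega> * cnj (G (z y) \<omega>))" for x y
    by (rule Bochner_Integration.integrable_bound[OF Bochner_Integration.integrable_add[OF sq[of x] sq[of y]]])
      (use bound in \<open>auto simp: norm_mult\<close>)
  have eq: "Gamma_eps_deriv G \<epsilon> x \<omega> * Gamma_eps_deriv G \<epsilon> y \<omega> =
      2 * Re (G (z x) \<omega> * G (z y) \<omega>) + 2 * Re (G (z x) \<omega> * cnj (G (z y) \<omega>))" for \<omega>
    by (simp add: Gamma_eps_deriv_def conj_process_def z_def complex_cnj algebra_simps)
  show "integrable M (\<lambda>\<omega>. Gamma_eps_deriv G \<epsilon> x \<omega> * Gamma_eps_deriv G \<epsilon> y \<omega>)"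
    unfolding eq by (intro Bochner_Integration.integrable_add integrable_mult_right integrable_Re int1 int2)
  have "(LINT \<omega>|M. Gamma_eps_deriv G \<epsilon> x \<omega> * Gamma_eps_deriv G \<epsilon> y \<omega>) =
      2 * Re (LINT \<omega>|M. G (z x) \<omega> * G (z y) \<omega>) + 2 * Re (LINT \<omega>|M. G (z x) \<omega> * cnj (G (z y) \<omega>))"
    unfolding eq integral_Re[OF int1, symmetric] integral_Re[OF int2, symmetric]
    by (simp add: integrable_Re int1 int2 del: times_complex.sel)
  also have "\<dots> = half_var'' (2 * \<alpha>) (2 * \<epsilon>) (x - y)"
    unfolding GG Gcnj half_var''_def c_def by simp
  finally show "(LINT \<omega>|M. Gamma_eps_deriv G \<epsilon> x \<omega> * Gamma_eps_deriv G \<epsilon> y \<omega>) =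
      half_var'' (2 * \<alpha>) (2 * \<epsilon>) (x - y)" .
qed

text \<open>Independence factorises the fourth moments of \<open>\<Gamma>'(\<epsilon>1)\<^sup>(\<^sup>1\<^sup>)\<close> and \<open>\<Gamma>'(\<epsilon>2)\<^sup>(\<^sup>2\<^sup>)\<close> into the product of the two covariance
  kernels, and the resulting fourfold integral is the one evaluated above.\<close>

lemma area_second_moment_eq:
  assumes \<alpha>: "\<alpha> \<in> {0<..<1}" "\<alpha> \<noteq> 1/2" and t: "t \<ge> 0" and M: "prob_space M"
    and G1: "fbm_gamma_deriv \<alpha> M G1" and G2: "fbm_gamma_deriv \<alpha> M G2"
    and indep: "independent_processes M G1 G2"
    and \<epsilon>: "\<epsilon>1 > 0" "\<epsilon>2 > 0"
  shows "area_second_moment M G1 G2 \<epsilon>1 \<epsilon>2 t =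
    integral {0..t} (\<lambda>x. (2 * half_var (2 * \<alpha>) (2 * \<epsilon>2) x - half_var (2 * \<alpha>) (2 * \<epsilon>2) 0) *
        (half_var' (2 * \<alpha>) (2 * \<epsilon>1) x - half_var' (2 * \<alpha>) (2 * \<epsilon>1) (x - t))) -
    2 * integral {0..t} (\<lambda>x. integral {0..x} (\<lambda>s. half_var'' (2 * \<alpha>) (2 * \<epsilon>1) s * half_var (2 * \<alpha>) (2 * \<epsilon>2) s))"
proof -
  interpret prob_space M by fact
  let ?X = "Gamma_eps_deriv G1 \<epsilon>1" and ?Y = "Gamma_eps_deriv G2 \<epsilon>2"
  have meas: "Gamma_eps_deriv G \<epsilon> x \<in> borel_measurable M"
    if "fbm_gamma_deriv \<alpha> M G" "\<epsilon> > 0" for G \<epsilon> x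
  proof -
    have "G (Complex x \<epsilon>) \<in> borel_measurable M"
      using that by (auto simp: fbm_gamma_deriv_def complex_gaussian_process_def upper_half_plane_def)
    then show ?thesis unfolding Gamma_eps_deriv_def conj_process_def complex_cnj minus_minus by measurable
  qed
  have cont: "AE \<omega> in M. continuous_on UNIV (\<lambda>x. Gamma_eps_deriv G \<epsilon> x \<omega>)"
    if "fbm_gamma_deriv \<alpha> M G" "\<epsilon> > 0" for G \<epsilon>
  proof -
    have "AE \<omega> in M. (\<lambda>z. G z \<omega>) analytic_on upper_half_plane"
      using that by (simp add: fbm_gamma_deriv_def)
    then show ?thesis
    proof eventually_elim
      fix \<omega> assume "(\<lambda>z. G z \<omega>) analytic_on upper_half_plane"
      then have "continuous_on upper_half_plane (\<lambda>z. G z \<omega>)"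
        using analytic_imp_holomorphic holomorphic_on_imp_continuous_on by blast
      moreover have "continuous_on UNIV (\<lambda>x. Complex x \<epsilon>)"
        by (auto simp: Complex_eq intro!: continuous_intros)
      ultimately have "continuous_on UNIV (\<lambda>x. G (Complex x \<epsilon>) \<omega>)"
        by (rule continuous_on_compose2) (use that in \<open>auto simp: upper_half_plane_def\<close>)
      then show "continuous_on UNIV (\<lambda>x. Gamma_eps_deriv G \<epsilon> x \<omega>)"
        unfolding Gamma_eps_deriv_def conj_process_def complex_cnj minus_minus
        by (intro continuous_intros)
    qed
  qed
  have ind: "indep_var borel (\<lambda>\<omega>. ?X x \<omega> * ?X y \<omega>) borel (\<lambda>\<omega>. ?Y u \<omega> * ?Y v \<omega>)" for x y u v
  proof -
    define g where "g \<epsilon> x y f = Re (f (Complex x \<epsilon>) + cnj (f (Complex x \<epsilon>))) * Re (f (Complex y \<epsilon>) + cnj (f (Complex y \<epsilon>)))"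
      for \<epsilon> x y :: real and f :: "complex \<Rightarrow> complex"
    have g: "g \<epsilon> x y \<in> PiM upper_half_plane (\<lambda>_. borel) \<rightarrow>\<^sub>M borel" if "\<epsilon> > 0" for \<epsilon> x y
    proof -
      have [measurable]: "(\<lambda>f. f (Complex x \<epsilon>)) \<in> PiM upper_half_plane (\<lambda>_. borel :: complex measure) \<rightarrow>\<^sub>M borel" for x
        by (rule measurable_component_singleton) (use that in \<open>simp add: upper_half_plane_def\<close>)
      show ?thesis unfolding g_def[abs_def] by measurable
    qed
    have "Complex x \<epsilon>1 \<in> upper_half_plane" "Complex x \<epsilon>2 \<in> upper_half_plane" for x
      using \<epsilon> by (auto simp: upper_half_plane_def)
    then show ?thesis
      using indep_var_compose[OF indep[unfolded independent_processes_def] g[OF \<epsilon>(1), of x y] g[OF \<epsilon>(2), of u v]]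
      by (simp add: o_def g_def Gamma_eps_deriv_def conj_process_def complex_cnj)
  qed
  note m1 = fbm_gamma_deriv_moments[OF \<alpha> G1 \<epsilon>(1)] and m2 = fbm_gamma_deriv_moments[OF \<alpha> G2 \<epsilon>(2)]
  have swap: "(?X x \<omega> * ?Y u \<omega>) * (?X y \<omega> * ?Y v \<omega>) = (?X x \<omega> * ?X y \<omega>) * (?Y u \<omega> * ?Y v \<omega>)" for x y u v \<omega>
    by (simp only: mult_ac)
  have e: "2 * \<epsilon>1 > 0" "2 * \<epsilon>2 > 0" using \<epsilon> by auto
  have "area_second_moment M G1 G2 \<epsilon>1 \<epsilon>2 t = integral {0..t} (\<lambda>x. integral {0..x} (\<lambda>u. integral {0..t} (\<lambda>y.
      integral {0..y} (\<lambda>v. half_var'' (2 * \<alpha>) (2 * \<epsilon>1) (x - y) * half_var'' (2 * \<alpha>) (2 * \<epsilon>2) (u - v)))))"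
    unfolding area_second_moment_def iterated_integral_def
  proof (rule second_moment_iterated_integral[OF M, where X = "?X" and Y = "?Y" and
        k = "half_var'' (2 * \<alpha>) (2 * \<epsilon>1)" and l = "half_var'' (2 * \<alpha>) (2 * \<epsilon>2)" and ?l1.0 = "half_var' (2 * \<alpha>) (2 * \<epsilon>2)"])
    show "integrable M (\<lambda>\<omega>. (?X x \<omega> * ?Y u \<omega>) * (?X y \<omega> * ?Y v \<omega>))" for x y u v
      by (rule iffD1[OF Bochner_Integration.integrable_cong[OF refl swap[symmetric]]
            indep_var_integrable[OF ind m1(1) m2(1)]])
    show "(LINT \<omega>|M. (?X x \<omega> * ?Y u \<omega>) * (?X y \<omega> * ?Y v \<omega>)) =
       half_var'' (2 * \<alpha>) (2 * \<epsilon>1) (x - y) * half_var'' (2 * \<alpha>) (2 * \<epsilon>2) (u - v)" for x y u v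
    proof -
      have "(LINT \<omega>|M. (?X x \<omega> * ?Y u \<omega>) * (?X y \<omega> * ?Y v \<omega>)) =
          (LINT \<omega>|M. (?X x \<omega> * ?X y \<omega>) * (?Y u \<omega> * ?Y v \<omega>))"
        by (rule Bochner_Integration.integral_cong[OF refl swap])
      then show ?thesis
        by (simp only: indep_var_lebesgue_integral[OF ind m1(1) m2(1)] m1(2) m2(2))
    qed
  qed (rule meas[OF G1 \<epsilon>(1)] meas[OF G2 \<epsilon>(2)] cont[OF G1 \<epsilon>(1)] cont[OF G2 \<epsilon>(2)]
        continuous_on_half_var(3)[OF e(1)] continuous_on_half_var(3)[OF e(2)] DERIV_half_var'[OF e(2)])+
  also have "\<dots> = integral {0..t} (\<lambda>x. (2 * half_var (2 * \<alpha>) (2 * \<epsilon>2) x - half_var (2 * \<alpha>) (2 * \<epsilon>2) 0) *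
        (half_var' (2 * \<alpha>) (2 * \<epsilon>1) x - half_var' (2 * \<alpha>) (2 * \<epsilon>1) (x - t))) -
    2 * integral {0..t} (\<lambda>x. integral {0..x} (\<lambda>s. half_var'' (2 * \<alpha>) (2 * \<epsilon>1) s * half_var (2 * \<alpha>) (2 * \<epsilon>2) s))"
    by (rule integral_convolution_second_derivatives[where ?f1.0 = "half_var' (2 * \<alpha>) (2 * \<epsilon>1)" and
          ?f2.0 = "half_var'' (2 * \<alpha>) (2 * \<epsilon>1)" and g = "half_var (2 * \<alpha>) (2 * \<epsilon>2)" and
          ?g1.0 = "half_var' (2 * \<alpha>) (2 * \<epsilon>2)" and ?g2.0 = "half_var'' (2 * \<alpha>) (2 * \<epsilon>2)"])
      (rule DERIV_half_var DERIV_half_var' continuous_on_half_var half_var_minus e t)+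
  finally show ?thesis .
qed

section \<open>Convergence along the joint filter\<close>

text \<open>A failure of convergence along the filter is witnessed by a sequence of pairs, chosen within ever smaller
  neighbourhoods. The ratio enters through \<open>\<epsilon>2 \<le> 2 * \<epsilon>1\<close>, a consequence of \<open>\<epsilon>1 / \<epsilon>2 > 1 / 2\<close>.\<close>

lemma tendsto_jointly_to_zeroI:
  fixes V :: "real \<times> real \<Rightarrow> real"
  assumes seq: "\<And>\<epsilon>1 \<epsilon>2. \<lbrakk>\<And>n. 0 < \<epsilon>1 n; \<And>n. 0 < \<epsilon>2 n; \<And>n. 2 * \<epsilon>1 n \<le> 1; \<And>n. 2 * \<epsilon>2 n \<le> 1;
      \<And>n. \<epsilon>2 n \<le> 2 * \<epsilon>1 n; \<epsilon>1 \<longlonglongrightarrow> 0; \<epsilon>2 \<longlonglongrightarrow> 0\<rbrakk> \<Longrightarrow> (\<lambda>n. V (\<epsilon>1 n, \<epsilon>2 n)) \<longlonglongrightarrow> L"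
  shows "(V \<longlongrightarrow> L) jointly_to_zero"
proof (rule ccontr)
  assume "\<not> (V \<longlongrightarrow> L) jointly_to_zero"
  then obtain r where r: "r > 0" "\<not> (\<forall>\<^sub>F p in jointly_to_zero. dist (V p) L < r)"
    unfolding tendsto_iff by blast
  \<comment> \<open>The factor 2 ensures \<open>2 * \<epsilon>1 \<le> 1\<close> and \<open>2 * \<epsilon>2 \<le> 1\<close> for every pair of the sequence.\<close>
  define \<delta> where "\<delta> n = 1 / (2 * real (Suc n))" for n
  have \<delta>: "\<delta> n > 0" "\<delta> n \<le> 1 / 2" for n
    by (auto simp: \<delta>_def divide_simps)
  let ?near = "\<lambda>n p. 0 < fst p \<and> fst p < \<delta> n \<and> 0 < snd p \<and> snd p < \<delta> n \<and> snd p \<le> 2 * fst p"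
  have near: "\<forall>\<^sub>F p in jointly_to_zero. ?near n p" for n
  proof -
    have small: "\<forall>\<^sub>F x in at_right 0. 0 < x \<and> x < \<delta> n"
      using eventually_at_right_less[of "0::real"] \<delta>(1)[of n]
      by (auto simp: eventually_at_right_field intro: exI[of _ "\<delta> n"])
    have 1: "\<forall>\<^sub>F p in at_right 0 \<times>\<^sub>F at_right 0. (0 < fst p \<and> fst p < \<delta> n) \<and> (0 < snd p \<and> snd p < \<delta> n)"
      using eventually_prodI[OF small small] by simp
    have 2: "\<forall>\<^sub>F p in filtercomap (\<lambda>(\<epsilon>1, \<epsilon>2). \<epsilon>1 / \<epsilon>2) (nhds (1::real)). fst p / snd p > 1 / 2"
      using eventually_filtercomapI[OF order_tendstoD(1)[OF filterlim_ident, of "1/2" "1::real"], of "\<lambda>(\<epsilon>1, \<epsilon>2). \<epsilon>1 / \<epsilon>2"]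
      by (simp add: split_beta)
    have "\<forall>\<^sub>F p in jointly_to_zero. ((0 < fst p \<and> fst p < \<delta> n) \<and> (0 < snd p \<and> snd p < \<delta> n)) \<and> fst p / snd p > 1 / 2"
      unfolding jointly_to_zero_def eventually_inf using 1 2 by blast
    then show ?thesis
      by eventually_elim (auto simp: divide_simps)
  qed
  have "\<exists>p. ?near n p \<and> \<not> dist (V p) L < r" for n
  proof (rule ccontr)
    assume "\<nexists>p. ?near n p \<and> \<not> dist (V p) L < r"
    then have "\<forall>\<^sub>F p in jointly_to_zero. dist (V p) L < r"
      by (intro eventually_mono[OF near[of n]]) blast
    with r(2) show False ..
  qed
  then have "\<forall>n. \<exists>p. ?near n p \<and> \<not> dist (V p) L < r" ..
  from choice[OF this] obtain p where "\<forall>n. ?near n (p n) \<and> \<not> dist (V (p n)) L < r" ..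
  then have p: "?near n (p n)" "\<not> dist (V (p n)) L < r" for n
    by simp_all
  have \<delta>0: "\<delta> \<longlonglongrightarrow> 0"
    using tendsto_mult_right_zero[OF LIMSEQ_inverse_real_of_nat, of "1/2"]
    by (simp add: \<delta>_def[abs_def] field_simps)
  have "(\<lambda>n. V (fst (p n), snd (p n))) \<longlonglongrightarrow> L"
  proof (rule seq)
    show "(\<lambda>n. fst (p n)) \<longlonglongrightarrow> 0" "(\<lambda>n. snd (p n)) \<longlonglongrightarrow> 0"
      using p(1) by (auto intro!: tendsto_sandwich[OF _ _ tendsto_const \<delta>0] always_eventually simp: less_imp_le)
    show "2 * fst (p n) \<le> 1" "2 * snd (p n) \<le> 1" for n
      using p(1)[of n] \<delta>(2)[of n] by auto
  qed (use p(1) in auto)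
  then have "\<forall>\<^sub>F n in sequentially. dist (V (p n)) L < r"
    using r(1) by (simp add: tendsto_iff)
  then show False
    using p(2) by (auto simp: eventually_sequentially)
qed

theorem theorem4p4:
  fixes \<alpha> t :: real and M :: "'a measure" and G1 G2 :: "complex \<Rightarrow> 'a \<Rightarrow> complex"
  assumes "\<alpha> \<in> {0<..<1}" and "\<alpha> > 1/4" and "\<alpha> \<noteq> 1/2" and "t > 0"
    and "prob_space M"
    and "fbm_gamma_deriv \<alpha> M G1" and "fbm_gamma_deriv \<alpha> M G2"
    and "independent_processes M G1 G2"
  shows "((\<lambda>(\<epsilon>1, \<epsilon>2). area_second_moment M G1 G2 \<epsilon>1 \<epsilon>2 t) \<longlongrightarrow> C_area \<alpha> * t powr (4 * \<alpha>))
           jointly_to_zero"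
proof (rule tendsto_jointly_to_zeroI)
  fix \<epsilon>1 \<epsilon>2 :: "nat \<Rightarrow> real"
  assume \<epsilon>: "\<And>n. 0 < \<epsilon>1 n" "\<And>n. 0 < \<epsilon>2 n" "\<And>n. 2 * \<epsilon>1 n \<le> 1" "\<And>n. 2 * \<epsilon>2 n \<le> 1"
    "\<And>n. \<epsilon>2 n \<le> 2 * \<epsilon>1 n" "\<epsilon>1 \<longlonglongrightarrow> 0" "\<epsilon>2 \<longlonglongrightarrow> 0"
  let ?a = "2 * \<alpha>"
  have a: "1 / 2 < ?a" "?a < 2" "?a \<noteq> 1" using assms by auto
  have e: "\<And>n. 0 < 2 * \<epsilon>1 n" "(\<lambda>n. 2 * \<epsilon>1 n) \<longlonglongrightarrow> 0" "\<And>n. 0 < 2 * \<epsilon>2 n" "(\<lambda>n. 2 * \<epsilon>2 n) \<longlonglongrightarrow> 0"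
    "\<And>n. 2 * \<epsilon>2 n \<le> 2 * (2 * \<epsilon>1 n)"
    using \<epsilon> by (auto intro: tendsto_mult_right_zero)
  note lim = cross_term_limit[OF a \<open>t > 0\<close> e(1) \<epsilon>(3) e(2) e(3) \<epsilon>(4) e(4) e(5)]
    diagonal_term_limit[OF a \<open>t > 0\<close> e(1) \<epsilon>(3) e(2) e(3) \<epsilon>(4) e(4) e(5)]
  have eq: "(case (\<epsilon>1 n, \<epsilon>2 n) of (\<epsilon>1, \<epsilon>2) \<Rightarrow> area_second_moment M G1 G2 \<epsilon>1 \<epsilon>2 t) =
    integral {0..t} (\<lambda>x. (2 * half_var (2 * \<alpha>) (2 * \<epsilon>2 n) x - half_var (2 * \<alpha>) (2 * \<epsilon>2 n) 0) *
        (half_var' (2 * \<alpha>) (2 * \<epsilon>1 n) x - half_var' (2 * \<alpha>) (2 * \<epsilon>1 n) (x - t))) -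
    2 * integral {0..t} (\<lambda>x. integral {0..x} (\<lambda>s. half_var'' (2 * \<alpha>) (2 * \<epsilon>1 n) s * half_var (2 * \<alpha>) (2 * \<epsilon>2 n) s))" for n
    unfolding prod.case using assms \<epsilon> by (intro area_second_moment_eq) auto
  have "t powr (2 * ?a) * (1 / 4 + ?a / 2 * Beta (?a + 1) ?a) -
      2 * (t powr (2 * ?a) * ((?a - 1) / (8 * (2 * ?a - 1)))) = C_area \<alpha> * t powr (4 * \<alpha>)"
  proof -
    \<comment> \<open>For \<open>\<alpha> < 1/2\<close> the argument \<open>2 * \<alpha> - 1\<close> is negative, but it lies above \<open>-1\<close>, so no pole of the Gamma function is met.\<close>
    have G: "(2 * \<alpha> - 1) * Gamma (2 * \<alpha> - 1) = Gamma (2 * \<alpha>)"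
    proof -
      have "2 * \<alpha> - 1 \<notin> \<int>\<^sub>\<le>\<^sub>0"
      proof
        assume "2 * \<alpha> - 1 \<in> \<int>\<^sub>\<le>\<^sub>0"
        then obtain n where n: "2 * \<alpha> - 1 = - real n" by (elim nonpos_Ints_cases')
        then have "real n < 1" using a by linarith
        then have "n = 0" by simp
        with n a show False by simp
      qed
      then show ?thesis using Gamma_plus1[of "2 * \<alpha> - 1"] by simp
    qed
    have "C_area \<alpha> = \<alpha> * ((2 * \<alpha> - 1) * Gamma (2 * \<alpha> - 1)) * Gamma (2 * \<alpha> + 1) / Gamma (4 * \<alpha> + 1)
        + \<alpha> * (2 * \<alpha> - 1) / 2 / ((2 * \<alpha> - 1) * (4 * \<alpha> - 1))"
      unfolding C_area_def distrib_left by simp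
    also have "\<alpha> * (2 * \<alpha> - 1) / 2 / ((2 * \<alpha> - 1) * (4 * \<alpha> - 1)) = \<alpha> / (2 * (4 * \<alpha> - 1))"
      using mult_divide_mult_cancel_left[of "2 * \<alpha> - 1" \<alpha> "2 * (4 * \<alpha> - 1)"] a
      by (simp add: mult.commute mult.left_commute)
    also have "\<alpha> * ((2 * \<alpha> - 1) * Gamma (2 * \<alpha> - 1)) * Gamma (2 * \<alpha> + 1) / Gamma (4 * \<alpha> + 1) =
        \<alpha> * Beta (?a + 1) ?a"
      unfolding G Beta_def by (simp add: mult_ac add_ac)
    also have "\<alpha> / (2 * (4 * \<alpha> - 1)) = 1 / 4 - 2 * ((?a - 1) / (8 * (2 * ?a - 1)))"
      using a by (simp add: field_simps)
    finally have C: "C_area \<alpha> = \<alpha> * Beta (?a + 1) ?a + (1 / 4 - 2 * ((?a - 1) / (8 * (2 * ?a - 1))))" .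
    have ring: "T * (1 / 4 + 2 * \<alpha> / 2 * B) - 2 * (T * Q) = (\<alpha> * B + (1 / 4 - 2 * Q)) * T" for T B Q
      by (simp add: algebra_simps)
    have "2 * ?a = 4 * \<alpha>" by simp
    then show ?thesis unfolding C by (simp only: ring)
  qed
  then show "(\<lambda>n. case (\<epsilon>1 n, \<epsilon>2 n) of (\<epsilon>1, \<epsilon>2) \<Rightarrow> area_second_moment M G1 G2 \<epsilon>1 \<epsilon>2 t)
      \<longlonglongrightarrow> C_area \<alpha> * t powr (4 * \<alpha>)"
    unfolding eq using tendsto_diff[OF lim(1) tendsto_mult_left[OF lim(2), of 2]] by (simp only:)
qed

end
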